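(* Let $n,m\geq 1$ be integers and let $W\in C^{2,\alpha}(\mathbb{R}^m,\mathbb{R})$ with $0<\alpha<1$ be such that for some constant $R>0$: $$v\in\mathbb{R}^m,\ |v|>R\ \Longrightarrow\ v\cdot\nabla W(v)>0.$$ Let $u\in C^2(\mathbb{R}^n;\mathbb{R}^m)\cap L^\infty(\mathbb{R}^n;\mathbb{R}^m)$ be a solution of $\Delta u=\nabla W(u)$ on all of $\mathbb{R}^n$. Then there is a constant $C>0$, depending only on $W$ and $\|u\|_{L^\infty(\mathbb{R}^n;\mathbb{R}^m)}$, such that for every $x\in\mathbb{R}^n$ $$\frac12|\nabla u(x)|^2\leq C\,(R^2-|u(x)|^2).$$ In particular, $|u(x)|\leq R$ for all $x\in\mathbb{R}^n$, and if $u$ is not constant, then $|u(x)|<R$ for all $x\in\mathbb{R}^n$.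
   Context: $|\cdot|$ is the Euclidean norm, and $|\nabla u|^2=\sum_{i=1}^n|u_{x_i}|^2$ where $u_{x_i}=\partial u/\partial x_i\in\mathbb{R}^m$. $\Delta u$ is the componentwise Laplacian. *)

theory Defs
  imports "HOL-Probability.Essential_Supremum"
begin

text \<open>The constant in the theorem must not depend on the dimension \<open>n\<close> of the domain, so \<open>n\<close> has
  to be quantified inside the statement and cannot be a type. The domain \<open>\<real>\<^sup>n\<close> is therefore
  represented by the functions \<open>nat \<Rightarrow> real\<close> that are \<open>undefined\<close> outside \<open>{..<n}\<close>. The
  product topology of \<open>nat \<Rightarrow> real\<close> restricts to the Euclidean topology on it, and it is the
  space of the product measure \<open>lebesgue_n n\<close>. A map on \<open>\<real>\<^sup>n\<close> is a function on
  \<open>nat \<Rightarrow> real\<close> whose values outside \<open>Rn n\<close> are never used. The target \<open>\<real>\<^sup>m\<close>, whose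
  dimension is determined by \<open>W\<close>, is \<open>real ^ 'm\<close>.\<close>

definition Rn :: "nat \<Rightarrow> (nat \<Rightarrow> real) set"
  where "Rn n = PiE {..<n} (\<lambda>_. UNIV)"

definition lebesgue_n :: "nat \<Rightarrow> (nat \<Rightarrow> real) measure"
  where "lebesgue_n n = PiM {..<n} (\<lambda>_. lborel)"

definition partial :: "nat \<Rightarrow> ((nat \<Rightarrow> real) \<Rightarrow> 'b::real_normed_vector) \<Rightarrow> (nat \<Rightarrow> real) \<Rightarrow> 'b"
  where "partial i f x = vector_derivative (\<lambda>t. f (x(i := t))) (at (x i))"

primrec Ck :: "nat \<Rightarrow> nat \<Rightarrow> ((nat \<Rightarrow> real) \<Rightarrow> 'b::real_normed_vector) \<Rightarrow> bool"
  where
    "Ck n 0 f \<longleftrightarrow> continuous_on (Rn n) f"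
  | "Ck n (Suc k) f \<longleftrightarrow> continuous_on (Rn n) f \<and>
       (\<forall>i<n. (\<forall>x\<in>Rn n. (\<lambda>t. f (x(i := t))) differentiable (at (x i))) \<and> Ck n k (partial i f))"

definition laplacian :: "nat \<Rightarrow> ((nat \<Rightarrow> real) \<Rightarrow> 'b::real_normed_vector) \<Rightarrow> (nat \<Rightarrow> real) \<Rightarrow> 'b"
  where "laplacian n f x = (\<Sum>i<n. partial i (partial i f) x)"

definition grad_norm_sq :: "nat \<Rightarrow> ((nat \<Rightarrow> real) \<Rightarrow> 'b::real_normed_vector) \<Rightarrow> (nat \<Rightarrow> real) \<Rightarrow> real"
  where "grad_norm_sq n f x = (\<Sum>i<n. (norm (partial i f x))\<^sup>2)"

text \<open>Since \<open>esssup\<close> is infinite for non-measurable functions, \<open>Linf_norm n f\<close> is finite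
  exactly if \<open>norm \<circ> f\<close> is measurable and essentially bounded.\<close>

definition Linf_norm :: "nat \<Rightarrow> ((nat \<Rightarrow> real) \<Rightarrow> 'b::real_normed_vector) \<Rightarrow> ereal"
  where "Linf_norm n f = esssup (lebesgue_n n) (\<lambda>x. ereal (norm (f x)))"

definition grad :: "('a::real_inner \<Rightarrow> real) \<Rightarrow> 'a \<Rightarrow> 'a"
  where "grad f v = (THE D. GDERIV f v :> D)"

text \<open>As \<open>\<real>\<^sup>m\<close> is open, the Hoelder condition on the Hessian is the local one, i.e.
  it is required on every compact set; the globally Hoelder functions are a subclass.\<close>

definition C2_holder :: "real \<Rightarrow> (real ^ 'm \<Rightarrow> real) \<Rightarrow> bool"
  where "C2_holder \<alpha> W \<longleftrightarrow>
    (\<forall>v. W differentiable (at v)) \<and>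
    (\<forall>v. grad W differentiable (at v)) \<and>
    (\<forall>K. compact K \<longrightarrow> (\<exists>L. \<forall>v\<in>K. \<forall>w\<in>K.
       norm (jacobian (grad W) (at v) - jacobian (grad W) (at w)) \<le> L * norm (v - w) powr \<alpha>))"

end

theory Submission
  imports Defs
begin

text \<open>Let \<open>R\<close> be the least admissible radius and \<open>\<Lambda>\<close> a Lipschitz constant of \<open>\<nabla>W\<close> on a ball
  containing the values of \<open>u\<close> and the ball of radius \<open>R\<close>. The function
  \<open>P = \<bar>\<nabla>u\<bar>\<^sup>2 / 2 + C (\<bar>u\<bar>\<^sup>2 - R\<^sup>2)\<close> with \<open>C = \<Lambda> + 1\<close> satisfies \<open>\<Delta>P \<ge> \<theta> > 0\<close> wherever
  \<open>P \<ge> \<epsilon> > 0\<close>, because \<open>v \<bullet> \<nabla>W v \<ge> - \<Lambda> (R\<^sup>2 - \<bar>v\<bar>\<^sup>2)\<close> inside the ball of radius \<open>R\<close>; as \<open>P\<close>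
  is bounded, the maximum principle for \<open>P - \<eta> \<bar>x - x0\<bar>\<^sup>2\<close> excludes this.
  Since \<open>u\<close> is only \<open>C\<^sup>2\<close>, the gradient in \<open>P\<close> is replaced by difference quotients of step
  \<open>h\<close>. The error is \<open>O(h)\<close> uniformly on the whole space since \<open>\<nabla>u\<close> is bounded and Lipschitz:
  Brandt's interior gradient estimate (maximum principle for the odd part of \<open>u\<close> under a
  reflection) is applied first to \<open>u\<close> and then to \<open>u(x + h e\<^sub>i) - u(x)\<close>.
  The strict inequality is the strong maximum principle for \<open>f = R\<^sup>2 - \<bar>u\<bar>\<^sup>2 \<ge> 0\<close>, which
  satisfies \<open>\<Delta>f \<le> 2 \<Lambda> f\<close>.\<close>

section \<open>Second partial derivatives along coordinate lines\<close>

text \<open>If \<open>d\<close> were positive, \<open>f'\<close>, which vanishes at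
  \<open>a\<close>, would be positive just to the right of \<open>a\<close>, and \<open>f\<close>
  would increase beyond its maximum.\<close>

lemma second_derivative_nonpos_at_max:
  fixes f f' :: "real \<Rightarrow> real"
  assumes f: "\<And>t. (f has_real_derivative f' t) (at t)"
    and f': "(f' has_real_derivative d) (at a)"
    and r: "r > 0" and max: "\<And>t. \<bar>t - a\<bar> < r \<Longrightarrow> f t \<le> f a"
  shows "d \<le> 0"
proof (rule ccontr)
  assume "\<not> d \<le> 0"
  have "f' a = 0"
    using DERIV_local_max[OF f[of a] r] max by (simp add: abs_minus_commute)
  moreover obtain e where e: "e > 0" "\<And>h. 0 < h \<Longrightarrow> h < e \<Longrightarrow> f' a < f' (a + h)"
    using DERIV_pos_inc_right[OF f'] \<open>\<not> d \<le> 0\<close> by auto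
  define h where "h = min e r / 2"
  have h: "0 < h" "h < e" "h < r" using e r by (auto simp: h_def)
  have "f a < f (a + h)"
  proof (rule DERIV_pos_imp_increasing_open[of a "a + h" f])
    fix x assume "a < x" "x < a + h"
    then show "\<exists>y. (f has_real_derivative y) (at x) \<and> 0 < y"
      using e(2)[of "x - a"] h f[of x] \<open>f' a = 0\<close> by (intro exI[of _ "f' x"]) auto
  next
    show "continuous_on {a..a + h} f"
      by (rule DERIV_continuous_on) (rule has_field_derivative_at_within[OF f])
  qed (use h in auto)
  with max[of "a + h"] h show False by simp
qed

text \<open>The derivatives are carried as data, so that the closure rules below compute those of
  comparison functions by unification. Only pure second derivatives are recorded;
  \<open>\<Sum>j<n. E j x\<close> is the Laplacian.\<close>

definition twice_partial ::
  "nat \<Rightarrow> ((nat \<Rightarrow> real) \<Rightarrow> 'b::real_normed_vector) \<Rightarrow> (nat \<Rightarrow> (nat \<Rightarrow> real) \<Rightarrow> 'b) \<Rightarrow>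
     (nat \<Rightarrow> (nat \<Rightarrow> real) \<Rightarrow> 'b) \<Rightarrow> bool"
  where "twice_partial n f D E \<longleftrightarrow> continuous_on (Rn n) f \<and>
    (\<forall>j<n. \<forall>x\<in>Rn n. ((\<lambda>t. f (x(j := t))) has_vector_derivative D j x) (at (x j)) \<and>
      ((\<lambda>t. D j (x(j := t))) has_vector_derivative E j x) (at (x j)))"

lemma Rn_upd: "x \<in> Rn n \<Longrightarrow> j < n \<Longrightarrow> x(j := t) \<in> Rn n"
  by (auto simp: Rn_def PiE_iff extensional_def)

lemma twice_partialI:
  assumes "continuous_on (Rn n) f"
    and "\<And>j x. j < n \<Longrightarrow> x \<in> Rn n \<Longrightarrow> ((\<lambda>t. f (x(j := t))) has_vector_derivative D j x) (at (x j))"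
    and "\<And>j x. j < n \<Longrightarrow> x \<in> Rn n \<Longrightarrow> ((\<lambda>t. D j (x(j := t))) has_vector_derivative E j x) (at (x j))"
  shows "twice_partial n f D E"
  using assms by (auto simp: twice_partial_def)

lemma twice_partialD:
  assumes "twice_partial n f D E"
  shows "continuous_on (Rn n) f"
    and "\<And>j x. j < n \<Longrightarrow> x \<in> Rn n \<Longrightarrow> ((\<lambda>t. f (x(j := t))) has_vector_derivative D j x) (at (x j))"
    and "\<And>j x. j < n \<Longrightarrow> x \<in> Rn n \<Longrightarrow> ((\<lambda>t. D j (x(j := t))) has_vector_derivative E j x) (at (x j))"
  using assms by (auto simp: twice_partial_def)

lemma twice_partial_line:
  assumes "twice_partial n f D E" "j < n" "x \<in> Rn n"
  shows "((\<lambda>t. f (x(j := t))) has_vector_derivative D j (x(j := t))) (at t)"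
  using twice_partialD(2)[OF assms(1,2) Rn_upd[OF assms(3,2), of t]] by simp

lemma twice_partial_diff:
  assumes "twice_partial n f D E" "twice_partial n f' D' E'"
  shows "twice_partial n (\<lambda>x. f x - f' x) (\<lambda>j x. D j x - D' j x) (\<lambda>j x. E j x - E' j x)"
  by (intro twice_partialI continuous_on_diff has_vector_derivative_diff
      twice_partialD[OF assms(1)] twice_partialD[OF assms(2)])

lemma twice_partial_add:
  assumes "twice_partial n f D E" "twice_partial n f' D' E'"
  shows "twice_partial n (\<lambda>x. f x + f' x) (\<lambda>j x. D j x + D' j x) (\<lambda>j x. E j x + E' j x)"
  by (intro twice_partialI continuous_on_add has_vector_derivative_add
      twice_partialD[OF assms(1)] twice_partialD[OF assms(2)])

lemma twice_partial_sum:
  assumes "\<And>i. i \<in> I \<Longrightarrow> twice_partial n (f i) (D i) (E i)"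
  shows "twice_partial n (\<lambda>x. \<Sum>i\<in>I. f i x) (\<lambda>j x. \<Sum>i\<in>I. D i j x) (\<lambda>j x. \<Sum>i\<in>I. E i j x)"
  by (intro twice_partialI continuous_on_sum has_vector_derivative_sum twice_partialD[OF assms])

lemma twice_partial_const: "twice_partial n (\<lambda>x. c) (\<lambda>j x. 0) (\<lambda>j x. 0)"
  by (intro twice_partialI continuous_on_const has_vector_derivative_const)

lemma twice_partial_bounded_linear:
  assumes "bounded_linear L" "twice_partial n f D E"
  shows "twice_partial n (\<lambda>x. L (f x)) (\<lambda>j x. L (D j x)) (\<lambda>j x. L (E j x))"
  by (intro twice_partialI bounded_linear.continuous_on[OF assms(1)]
      bounded_linear.has_vector_derivative[OF assms(1)] twice_partialD[OF assms(2)])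

text \<open>Covers translations (\<open>\<sigma> = 1\<close>) and reflections
  (\<open>\<sigma> = -1\<close>) of one coordinate; the factor \<open>\<sigma>\<close> enters a
  second derivative squared, so the Laplacian commutes with both.\<close>

lemma twice_partial_upd_affine:
  assumes f: "twice_partial n f D E" and i: "i < n" and \<sigma>: "\<sigma>\<^sup>2 = (1::real)"
  shows "twice_partial n (\<lambda>x. f (x(i := \<sigma> * x i + c)))
    (\<lambda>j x. (if j = i then \<sigma> else 1) *\<^sub>R D j (x(i := \<sigma> * x i + c)))
    (\<lambda>j x. E j (x(i := \<sigma> * x i + c)))"
proof (rule twice_partialI)
  have S: "x(i := \<sigma> * x i + c) \<in> Rn n" if "x \<in> Rn n" for x
    using that i by (rule Rn_upd)
  have "continuous_on (Rn n) (\<lambda>x. x(i := \<sigma> * x i + c))"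
  proof (rule continuous_on_coordinatewise_then_product)
    fix k
    show "continuous_on (Rn n) (\<lambda>x. (x(i := \<sigma> * x i + c)) k)"
      by (cases "k = i")
        (auto intro!: continuous_intros continuous_on_subset[OF continuous_on_product_coordinates])
  qed
  then show "continuous_on (Rn n) (\<lambda>x. f (x(i := \<sigma> * x i + c)))"
    using S by (intro continuous_on_compose2[OF twice_partialD(1)[OF f]]) auto
next
  fix j x assume j: "j < n" and x: "x \<in> Rn n"
  define y where "y = x(i := \<sigma> * x i + c)"
  have y: "y \<in> Rn n" unfolding y_def using x i by (rule Rn_upd)
  note d = twice_partialD[OF f] 
  have chain: "((\<lambda>t. g (y(i := \<sigma> * t + c))) has_vector_derivative \<sigma> *\<^sub>R e) (at (x i))"
    if "((\<lambda>t. g (y(i := t))) has_vector_derivative e) (at (y i))" for g :: "_ \<Rightarrow> 'a" and e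
  proof -
    have "((\<lambda>t. \<sigma> * t + c) has_vector_derivative \<sigma>) (at (x i))"
      by (auto intro!: derivative_eq_intros)
    from vector_diff_chain_at[OF this, of "\<lambda>t. g (y(i := t))" e] that
    show ?thesis by (simp add: y_def o_def)
  qed
  show "((\<lambda>t. f ((x(j := t))(i := \<sigma> * (x(j := t)) i + c))) has_vector_derivative
      (if j = i then \<sigma> else 1) *\<^sub>R D j (x(i := \<sigma> * x i + c))) (at (x j))"
  proof (cases "j = i")
    case True
    then show ?thesis using chain[of f, OF d(2)[OF i y]] by (simp add: y_def)
  next
    case False
    then show ?thesis using d(2)[OF j y] by (simp add: y_def fun_upd_twist)
  qed
  show "((\<lambda>t. (if j = i then \<sigma> else 1) *\<^sub>R D j ((x(j := t))(i := \<sigma> * (x(j := t)) i + c)))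
      has_vector_derivative E j (x(i := \<sigma> * x i + c))) (at (x j))"
  proof (cases "j = i")
    case True
    have "((\<lambda>t. \<sigma> *\<^sub>R D i (y(i := \<sigma> * t + c))) has_vector_derivative \<sigma> *\<^sub>R \<sigma> *\<^sub>R E i y) (at (x i))"
      by (intro bounded_linear.has_vector_derivative[OF bounded_linear_scaleR_right] chain d(3) i y)
    then show ?thesis using True \<sigma> by (simp add: y_def power2_eq_square)
  next
    case False
    then show ?thesis using d(3)[OF j y] by (simp add: y_def fun_upd_twist)
  qed
qed

text \<open>Summed over \<open>j\<close>, this says that the Laplacian of |f|^2/2 is |Df|^2 plus the
  inner product of f with its Laplacian. It is applied to \<open>u\<close> and to its difference
  quotients.\<close>

lemma twice_partial_half_norm_sq:
  fixes f :: "(nat \<Rightarrow> real) \<Rightarrow> 'b::real_inner"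
  assumes f: "twice_partial n f D E"
  shows "twice_partial n (\<lambda>x. 1/2 * (norm (f x))\<^sup>2) (\<lambda>j x. f x \<bullet> D j x)
    (\<lambda>j x. (norm (D j x))\<^sup>2 + f x \<bullet> E j x)"
proof (rule twice_partialI)
  note d = twice_partialD[OF f]
  show "continuous_on (Rn n) (\<lambda>x. 1/2 * (norm (f x))\<^sup>2)"
    by (intro continuous_intros d)
  fix j x assume j: "j < n" and x: "x \<in> Rn n"
  have *: "((\<lambda>t. p t \<bullet> q t) has_vector_derivative p (x j) \<bullet> q' + p' \<bullet> q (x j)) (at (x j))"
    if "(p has_vector_derivative p') (at (x j))" "(q has_vector_derivative q') (at (x j))"
    for p q :: "real \<Rightarrow> 'b" and p' q'
    by (rule bounded_bilinear.has_vector_derivative[OF bounded_bilinear_inner that])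
  have "((\<lambda>t. 1/2 * (f (x(j := t)) \<bullet> f (x(j := t)))) has_vector_derivative
      1/2 * (f x \<bullet> D j x + D j x \<bullet> f x)) (at (x j))"
    using bounded_linear.has_vector_derivative[OF bounded_linear_mult_right[of "1/2"] *[OF d(2)[OF j x] d(2)[OF j x]]]
    by simp
  then show "((\<lambda>t. 1/2 * (norm (f (x(j := t))))\<^sup>2) has_vector_derivative f x \<bullet> D j x) (at (x j))"
    by (simp add: power2_norm_eq_inner inner_commute)
  show "((\<lambda>t. f (x(j := t)) \<bullet> D j (x(j := t))) has_vector_derivative
      (norm (D j x))\<^sup>2 + f x \<bullet> E j x) (at (x j))"
    using *[OF d(2)[OF j x] d(3)[OF j x]] by (simp add: power2_norm_eq_inner add.commute)
qed

section \<open>Comparison functions\<close>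

definition dist_sq :: "nat \<Rightarrow> (nat \<Rightarrow> real) \<Rightarrow> (nat \<Rightarrow> real) \<Rightarrow> real"
  where "dist_sq n a x = (\<Sum>k<n. (x k - a k)\<^sup>2)"

lemma dist_sq_upd:
  assumes "j < n"
  shows "dist_sq n a (x(j := t)) = dist_sq n a x - (x j - a j)\<^sup>2 + (t - a j)\<^sup>2"
proof -
  have "dist_sq n a z = (z j - a j)\<^sup>2 + (\<Sum>k\<in>{..<n} - {j}. (z k - a k)\<^sup>2)" for z
    unfolding dist_sq_def using assms by (simp add: sum.remove)
  from this[of x] this[of "x(j := t)"] show ?thesis by simp
qed

lemma continuous_on_dist_sq: "continuous_on A (dist_sq n a)"
  unfolding dist_sq_def
  by (intro continuous_intros continuous_on_subset[OF continuous_on_product_coordinates]) auto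

lemma twice_partial_dist_sq:
  "twice_partial n (dist_sq n a) (\<lambda>j x. 2 * (x j - a j)) (\<lambda>j x. 2)"
proof (rule twice_partialI)
  show "continuous_on (Rn n) (dist_sq n a)" by (rule continuous_on_dist_sq)
  fix j x assume j: "j < n"
  have "((\<lambda>t. dist_sq n a x - (x j - a j)\<^sup>2 + (t - a j)\<^sup>2) has_real_derivative
      2 * (x j - a j)) (at (x j))"
    by (auto intro!: derivative_eq_intros)
  then show "((\<lambda>t. dist_sq n a (x(j := t))) has_vector_derivative 2 * (x j - a j)) (at (x j))"
    by (simp add: dist_sq_upd[OF j] has_real_derivative_iff_has_vector_derivative)
  have "((\<lambda>t. 2 * (t - a j)) has_real_derivative 2) (at (x j))"
    by (auto intro!: derivative_eq_intros)
  then show "((\<lambda>t. 2 * ((x(j := t)) j - a j)) has_vector_derivative 2) (at (x j))"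
    by (simp add: has_real_derivative_iff_has_vector_derivative)
qed

text \<open>The Gaussian of Hopf's barrier. Its Laplacian is
  \<open>4 * b\<^sup>2 * dist_sq n a x - 2 * n * b\<close> times the Gaussian, hence positive away
  from \<open>a\<close> once \<open>b\<close> is large.\<close>

lemma twice_partial_exp_dist_sq:
  "twice_partial n (\<lambda>x. exp (- (b * dist_sq n a x)))
     (\<lambda>j x. - (2 * b * (x j - a j) * exp (- (b * dist_sq n a x))))
     (\<lambda>j x. (4 * b\<^sup>2 * (x j - a j)\<^sup>2 - 2 * b) * exp (- (b * dist_sq n a x)))"
proof (rule twice_partialI)
  show "continuous_on (Rn n) (\<lambda>x. exp (- (b * dist_sq n a x)))"
    by (intro continuous_intros continuous_on_dist_sq)
  fix j x assume j: "j < n"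
  have d: "((\<lambda>t. exp (- (b * dist_sq n a (x(j := t))))) has_real_derivative
      - (2 * b * (x j - a j) * exp (- (b * dist_sq n a x)))) (at (x j))"
    unfolding dist_sq_upd[OF j] by (auto intro!: derivative_eq_intros)
  then show "((\<lambda>t. exp (- (b * dist_sq n a (x(j := t))))) has_vector_derivative
      - (2 * b * (x j - a j) * exp (- (b * dist_sq n a x)))) (at (x j))"
    by (simp add: has_real_derivative_iff_has_vector_derivative)
  have "((\<lambda>t. - (2 * b * (t - a j) * exp (- (b * dist_sq n a (x(j := t)))))) has_real_derivative
      - (2 * b * (x j - a j) * (- (2 * b * (x j - a j) * exp (- (b * dist_sq n a x))))
         + 2 * b * exp (- (b * dist_sq n a x)))) (at (x j))"
    by (rule derivative_eq_intros d refl | simp)+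
  then show "((\<lambda>t. - (2 * b * ((x(j := t)) j - a j) * exp (- (b * dist_sq n a (x(j := t))))))
      has_vector_derivative
      (4 * b\<^sup>2 * (x j - a j)\<^sup>2 - 2 * b) * exp (- (b * dist_sq n a x))) (at (x j))"
    by (simp add: has_real_derivative_iff_has_vector_derivative power2_eq_square algebra_simps)
qed

text \<open>The concave part of Brandt's barrier: with s = x i - a, the function s (2 - s) is 0 on
  the mirror s = 0, is 1 on the face s = 1, and has Laplacian -2.\<close>

lemma twice_partial_coord_quadratic:
  assumes "i < n"
  shows "twice_partial n (\<lambda>x. (x i - a) * (2 - (x i - a)))
    (\<lambda>j x. if j = i then 2 - 2 * (x i - a) else 0) (\<lambda>j x. if j = i then - 2 else 0)"
proof (rule twice_partialI)
  show "continuous_on (Rn n) (\<lambda>x. (x i - a) * (2 - (x i - a)))"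
    by (intro continuous_intros continuous_on_subset[OF continuous_on_product_coordinates]) auto
  fix j x assume j: "j < n"
  have "((\<lambda>t. (t - a) * (2 - (t - a))) has_real_derivative 2 - 2 * (x i - a)) (at (x i))"
    by (auto intro!: derivative_eq_intros)
  then show "((\<lambda>t. ((x(j := t)) i - a) * (2 - ((x(j := t)) i - a))) has_vector_derivative
      (if j = i then 2 - 2 * (x i - a) else 0)) (at (x j))"
    by (auto simp: has_real_derivative_iff_has_vector_derivative)
  have "((\<lambda>t. 2 - 2 * (t - a)) has_real_derivative - 2) (at (x i))"
    by (auto intro!: derivative_eq_intros)
  then show "((\<lambda>t. if j = i then 2 - 2 * ((x(j := t)) i - a) else 0) has_vector_derivative
      (if j = i then - 2 else 0)) (at (x j))"
    by (auto simp: has_real_derivative_iff_has_vector_derivative)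
qed

section \<open>Maximum principles\<close>

lemma compact_box: "compact (PiE {..<n} (\<lambda>j. {l j..u j :: real}))"
proof -
  \<comment> \<open>Outside \<open>{..<n}\<close> the factor is the compact singleton
    \<open>{undefined}\<close>, so Tychonoff's theorem applies to the product over all
    indices.\<close>
  have "PiE {..<n} (\<lambda>j. {l j..u j}) = PiE UNIV (\<lambda>j. if j < n then {l j..u j} else {undefined})"
    by (auto simp: PiE_iff extensional_def split: if_splits)
  also have "compactin (product_topology (\<lambda>i. euclidean) UNIV) \<dots>"
    by (auto simp: compactin_PiE)
  finally show ?thesis unfolding euclidean_product_topology compactin_euclidean_iff .
qed

lemma box_subset_Rn: "PiE {..<n} B \<subseteq> Rn n"
  unfolding Rn_def by (rule PiE_mono) simp

text \<open>The face values lie below \<open>f a\<close>, so the maximum over the box is attained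
  off the faces, where each pure second derivative is \<le> 0. Later proofs contradict this with a
  strictly positive Laplacian.\<close>

lemma box_interior_max:
  fixes f :: "(nat \<Rightarrow> real) \<Rightarrow> real"
  assumes f: "twice_partial n f D E" and a: "a \<in> PiE {..<n} (\<lambda>j. {l j..u j})"
    and bd: "\<And>x j. x \<in> PiE {..<n} (\<lambda>j. {l j..u j}) \<Longrightarrow> j < n \<Longrightarrow> x j = l j \<or> x j = u j \<Longrightarrow> f x < f a"
  obtains x where "x \<in> PiE {..<n} (\<lambda>j. {l j..u j})" "f a \<le> f x" "(\<Sum>j<n. E j x) \<le> 0"
proof -
  let ?B = "PiE {..<n} (\<lambda>j. {l j..u j})"
  have "\<exists>x\<in>?B. \<forall>y\<in>?B. f y \<le> f x"
    using a by (intro continuous_attains_sup compact_box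
        continuous_on_subset[OF twice_partialD(1)[OF f] box_subset_Rn]) auto
  then obtain x where x: "x \<in> ?B" and max: "\<And>y. y \<in> ?B \<Longrightarrow> f y \<le> f x"
    by (elim bexE) simp
  have xR: "x \<in> Rn n" using x box_subset_Rn by blast
  have "E j x \<le> 0" if j: "j < n" for j
  proof -
    have "x j \<in> {l j..u j}" using x j by (auto simp: PiE_iff)
    moreover have "x j \<noteq> l j" "x j \<noteq> u j" using bd[OF x j] max[OF a] by fastforce+
    ultimately have xj: "l j < x j" "x j < u j" by auto
    show ?thesis
    proof (rule second_derivative_nonpos_at_max[of "\<lambda>t. f (x(j := t))" "\<lambda>t. D j (x(j := t))" _ "x j"])
      show "((\<lambda>t. f (x(j := t))) has_real_derivative D j (x(j := t))) (at t)" for t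
        using twice_partial_line[OF f j xR]
        by (simp add: has_real_derivative_iff_has_vector_derivative)
      show "((\<lambda>t. D j (x(j := t))) has_real_derivative E j x) (at (x j))"
        using twice_partialD(3)[OF f j xR]
        by (simp add: has_real_derivative_iff_has_vector_derivative)
      show "0 < min (x j - l j) (u j - x j)" using xj by simp
      fix t assume "\<bar>t - x j\<bar> < min (x j - l j) (u j - x j)"
      then have "x(j := t) \<in> ?B" using x j by (auto simp: PiE_iff extensional_def)
      from max[OF this] show "f (x(j := t)) \<le> f (x(j := x j))" by simp
    qed
  qed
  then have "(\<Sum>j<n. E j x) \<le> 0" by (intro sum_nonpos) auto
  with that x max[OF a] show ?thesis by blast
qed

section \<open>Interior gradient bound\<close>

lemma dist_sq_nonneg: "0 \<le> dist_sq n a x"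
  by (simp add: dist_sq_def sum_nonneg)

lemma dist_sq_ge: "j < n \<Longrightarrow> (x j - a j)\<^sup>2 \<le> dist_sq n a x"
  unfolding dist_sq_def by (rule member_le_sum) auto

lemma box_halfwidth:
  assumes "j < n" "x j = a j - r \<or> x j = a j + r"
  shows "r\<^sup>2 \<le> dist_sq n a x"
  using dist_sq_ge[OF assms(1), of x a] assms(2) by auto

lemma dist_sq_self [simp]: "dist_sq n a a = 0"
  by (simp add: dist_sq_def)

text \<open>Brandt's argument: the odd part of \<open>f\<close> under the reflection of the \<open>i\<close>-th coordinate at \<open>a\<close>
  vanishes on the mirror, where it is compared with a quadratic barrier on a half cube.\<close>

lemma partial_upper_bound:
  fixes f :: "(nat \<Rightarrow> real) \<Rightarrow> real"
  assumes f: "twice_partial n f D E"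
    and M: "\<And>x. x \<in> Rn n \<Longrightarrow> \<bar>f x\<bar> \<le> M"
    and F: "\<And>x. x \<in> Rn n \<Longrightarrow> \<bar>\<Sum>j<n. E j x\<bar> \<le> F" "F > 0"
    and i: "i < n" and a: "a \<in> Rn n"
  shows "D i a \<le> 2 * (n * M + F)"
proof -
  \<comment> \<open>Two demands fix \<open>K\<close>: \<open>K \<ge> M\<close> lifts the barrier to
    \<open>2 * M\<close> on the face opposite the mirror, and
    \<open>4 * K - 4 * n * M = 4 * F\<close> exceeds the \<open>2 * F\<close> that the Laplacians of
    \<open>f\<close> and of its reflection can contribute.\<close>
  define K where "K = n * M + F"
  have M0: "M \<ge> 0" using M[OF a] by linarith
  have KM: "K \<ge> M" and K0: "K \<ge> 0"
    using i F(2) M0 mult_right_mono[of 1 "real n" M] by (auto simp: K_def)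
  define S where "S = (\<lambda>x::nat \<Rightarrow> real. x(i := -1 * x i + 2 * a i))"
  have SR: "S x \<in> Rn n" if "x \<in> Rn n" for x
    unfolding S_def using that i by (rule Rn_upd)
  define q where "q = (\<lambda>x::nat \<Rightarrow> real. (x i - a i) * (2 - (x i - a i)))"
  \<comment> \<open>The first term controls the lateral faces, the second the face opposite the
    mirror.\<close>
  define \<psi> where "\<psi> = (\<lambda>x. 2 * (M * dist_sq n a x + K * q x))"
  define g where "g = (\<lambda>x. (f x - f (S x)) - \<psi> x)"
  have g: "twice_partial n g
     (\<lambda>j x. (D j x - (if j = i then -1 else 1) *\<^sub>R D j (S x)) - 2 * (M * (2 * (x j - a j)) + K * (if j = i then 2 - 2 * (x i - a i) else 0)))
     (\<lambda>j x. (E j x - E j (S x)) - 2 * (M * 2 + K * (if j = i then - 2 else 0)))"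
    unfolding g_def \<psi>_def S_def q_def
    by (intro twice_partial_diff twice_partial_add f twice_partial_upd_affine i
        twice_partial_bounded_linear[OF bounded_linear_mult_right] twice_partial_dist_sq twice_partial_coord_quadratic) simp
  have g_le: "g x \<le> 2 * M - \<psi> x" if "x \<in> Rn n" for x
    using M[OF that] M[OF SR[OF that]] by (simp add: g_def abs_le_iff)
  \<comment> \<open>The half cube: the mirror is its lower face in direction
    \<open>i\<close>.\<close>
  define l where "l = (\<lambda>j. if j = i then a i else a j - 1)"
  define r where "r = (\<lambda>j. a j + 1)"
  let ?B = "PiE {..<n} (\<lambda>j. {l j..r j})"
  have g_nonpos: "g b \<le> 0" if b: "b \<in> ?B" for b
  proof (rule ccontr)
    assume "\<not> g b \<le> 0"
    have "g x \<le> 0" if x: "x \<in> ?B" and j: "j < n" and xj: "x j = l j \<or> x j = r j" for x j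
    proof -
      have xR: "x \<in> Rn n" using x box_subset_Rn by blast
      have "x i \<in> {l i..r i}" using x i by (auto simp: PiE_iff)
      then have q0: "q x \<ge> 0" by (auto simp: q_def l_def r_def)
      have nonneg: "0 \<le> M * dist_sq n a x" "0 \<le> K * q x"
        using M0 K0 q0 dist_sq_nonneg[of n a x] by auto
      \<comment> \<open>The mirror, the opposite face, and the lateral faces.\<close>
      consider "j = i" "x i = a i" | "j = i" "x i = a i + 1" | "j \<noteq> i" "(x j - a j)\<^sup>2 = 1"
        using xj by (auto simp: l_def r_def split: if_splits)
      then show ?thesis
      proof cases
        case 1
        then have "S x = x" by (auto simp: S_def)
        then show ?thesis using nonneg by (simp add: g_def \<psi>_def)
      next
        case 2
        then have "q x = 1" by (simp add: q_def)
        then have "\<psi> x \<ge> 2 * M" using KM nonneg by (simp add: \<psi>_def)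
        then show ?thesis using g_le[OF xR] by simp
      next
        case 3
        then have "M * 1 \<le> M * dist_sq n a x"
          using dist_sq_ge[OF j, of x a] M0 by (intro mult_left_mono) auto
        then have "\<psi> x \<ge> 2 * M" using nonneg by (simp add: \<psi>_def)
        then show ?thesis using g_le[OF xR] by simp
      qed
    qed
    then have bd: "\<And>x j. x \<in> ?B \<Longrightarrow> j < n \<Longrightarrow> x j = l j \<or> x j = r j \<Longrightarrow> g x < g b"
      using \<open>\<not> g b \<le> 0\<close> by force
    obtain x where x: "x \<in> ?B"
      and le: "(\<Sum>j<n. (E j x - E j (S x)) - 2 * (M * 2 + K * (if j = i then - 2 else 0))) \<le> 0"
      by (rule box_interior_max[OF g b bd])
    have xR: "x \<in> Rn n" using x box_subset_Rn by blast
    have "(\<Sum>j<n. (E j x - E j (S x)) - 2 * (M * 2 + K * (if j = i then - 2 else 0)))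
      = (\<Sum>j<n. E j x - E j (S x) - 4 * M + (if j = i then 4 * K else 0))"
      by (rule sum.cong) auto
    also have "\<dots> = (\<Sum>j<n. E j x) - (\<Sum>j<n. E j (S x)) - 4 * n * M + 4 * K"
      using i by (simp add: sum_subtractf sum.distrib)
    finally have "(\<Sum>j<n. E j x) - (\<Sum>j<n. E j (S x)) - 4 * n * M + 4 * K \<le> 0"
      using le by simp
    with F(1)[OF xR] F(1)[OF SR[OF xR]] F(2) show False by (simp add: K_def abs_le_iff)
  qed
  \<comment> \<open>\<open>g\<close> along the normal of the mirror at \<open>a\<close>. As
    \<open>p 0 = 0\<close> and \<open>p \<le> 0\<close> on [0, 1], the derivative
    \<open>2 * D i a - 4 * K\<close> at 0 cannot be positive.\<close>
  define p where "p = (\<lambda>s. f (a(i := a i + s)) - f (a(i := a i - s)) - 2 * (M * s\<^sup>2 + K * (s * (2 - s))))"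
  have p_nonpos: "p s \<le> 0" if "0 \<le> s" "s \<le> 1" for s
  proof -
    have "a(i := a i + s) \<in> ?B"
      using a that i by (auto simp: PiE_iff Rn_def l_def r_def extensional_def)
    moreover have "dist_sq n a (a(i := a i + s)) = s\<^sup>2"
      using i by (simp add: dist_sq_upd)
    ultimately show ?thesis using g_nonpos[of "a(i := a i + s)"]
      by (simp add: p_def g_def \<psi>_def q_def S_def)
  qed
  have "((\<lambda>t. f (a(i := t))) has_real_derivative D i a) (at (a i))"
    using twice_partialD(2)[OF f i a] by (simp add: has_real_derivative_iff_has_vector_derivative)
  then have d: "(g has_real_derivative g') (at 0) \<Longrightarrow> g 0 = a i \<Longrightarrow>
      ((\<lambda>s. f (a(i := g s))) has_real_derivative D i a * g') (at 0)" for g g'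
    by (intro DERIV_chain2[where f="\<lambda>t. f (a(i := t))"]) auto
  have "((\<lambda>s. f (a(i := a i + s))) has_real_derivative D i a * 1) (at 0)"
    and "((\<lambda>s. f (a(i := a i - s))) has_real_derivative D i a * - 1) (at 0)"
    by (rule d; auto intro!: derivative_eq_intros)+
  then have p': "(p has_real_derivative 2 * D i a - 4 * K) (at 0)"
    unfolding p_def by (auto intro!: derivative_eq_intros)
  have "\<not> 2 * D i a - 4 * K > 0"
  proof
    assume "2 * D i a - 4 * K > 0"
    from DERIV_pos_inc_right[OF p' this] obtain d where d: "d > 0" "\<And>h. 0 < h \<Longrightarrow> h < d \<Longrightarrow> p 0 < p (0 + h)"
      by blast
    have "p 0 < p (min d 1 / 2)" using d(2)[of "min d 1 / 2"] d(1) by simp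
    moreover have "p 0 = 0" by (simp add: p_def)
    moreover have "0 \<le> min d 1 / 2" "min d 1 / 2 \<le> 1" using d(1) by (auto simp: min_def)
    ultimately show False using p_nonpos[of "min d 1 / 2"] by simp
  qed
  then show ?thesis by (simp add: K_def)
qed

text \<open>The scalar estimate is applied to \<open>e \<bullet> f\<close>, where \<open>e\<close>
  is the unit vector along \<open>D i a\<close>; the constant is thus free of the target
  dimension.\<close>

lemma norm_partial_bound:
  fixes f :: "(nat \<Rightarrow> real) \<Rightarrow> 'b::real_inner"
  assumes f: "twice_partial n f D E"
    and M: "\<And>x. x \<in> Rn n \<Longrightarrow> norm (f x) \<le> M"
    and F: "\<And>x. x \<in> Rn n \<Longrightarrow> norm (\<Sum>j<n. E j x) \<le> F" "F > 0"
    and i: "i < n" and a: "a \<in> Rn n"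
  shows "norm (D i a) \<le> 2 * (n * M + F)"
proof (cases "D i a = 0")
  case True
  moreover have "0 \<le> n * M" using order_trans[OF norm_ge_zero M[OF a]] by simp
  ultimately show ?thesis using F(2) by simp
next
  case False
  define e where "e = D i a /\<^sub>R norm (D i a)"
  have e: "norm e = 1" "e \<bullet> D i a = norm (D i a)"
    using False by (auto simp: e_def power2_norm_eq_inner[symmetric] power2_eq_square)
  have le: "\<bar>e \<bullet> v\<bar> \<le> norm v" for v
    using Cauchy_Schwarz_ineq2[of e v] e by simp
  have "e \<bullet> D i a \<le> 2 * (n * M + F)"
    by (rule partial_upper_bound[OF twice_partial_bounded_linear[OF bounded_linear_inner_right f] _ _ F(2) i a])
      (auto simp: inner_sum_right[symmetric] intro: order_trans[OF le M] order_trans[OF le F(1)])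
  then show ?thesis using e by simp
qed

text \<open>Subtracting a flat paraboloid centred at \<open>a\<close> forces an interior maximum on
  a large cube. There \<open>f x \<ge> f a \<ge> \<epsilon>\<close>, and the Laplacian is still
  positive.\<close>

lemma bounded_subsolution_less:
  fixes f :: "(nat \<Rightarrow> real) \<Rightarrow> real"
  assumes f: "twice_partial n f D E"
    and B: "\<And>x. x \<in> Rn n \<Longrightarrow> f x \<le> B"
    and \<theta>: "\<theta> > 0" "\<And>x. x \<in> Rn n \<Longrightarrow> \<epsilon> \<le> f x \<Longrightarrow> \<theta> \<le> (\<Sum>j<n. E j x)"
    and a: "a \<in> Rn n"
  shows "f a < \<epsilon>"
proof (rule ccontr)
  assume "\<not> f a < \<epsilon>"
  \<comment> \<open>The paraboloid costs \<open>2 * n * \<eta>\<close> of Laplacian, strictly less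
    than \<open>\<theta>\<close>; the summand 1 also covers \<open>n = 0\<close>.\<close>
  define \<eta> where "\<eta> = \<theta> / (2 * n + 1)"
  have \<eta>: "\<eta> > 0" "2 * n * \<eta> < \<theta>" using \<theta>(1) by (auto simp: \<eta>_def field_simps)
  \<comment> \<open>On the faces the paraboloid is at least \<open>\<eta> * r\<^sup>2\<close>, which
    must exceed \<open>B - f a\<close>; \<open>r \<ge> 1\<close> allows comparing with
    \<open>\<eta> * r\<close>.\<close>
  define r where "r = 1 + (B - f a) / \<eta>"
  have r: "r \<ge> 1" using B[OF a] \<eta> by (simp add: r_def)
  have "r * 1 \<le> r * r" using r by (intro mult_left_mono) auto
  then have "\<eta> * r \<le> \<eta> * r\<^sup>2" using \<eta> by (simp add: power2_eq_square)
  moreover have "B - f a < \<eta> * r" using \<eta> by (simp add: r_def field_simps)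
  ultimately have r2: "B - f a < \<eta> * r\<^sup>2" by simp
  let ?g = "\<lambda>x. f x - \<eta> * dist_sq n a x"
  have g: "twice_partial n ?g (\<lambda>j x. D j x - \<eta> * (2 * (x j - a j))) (\<lambda>j x. E j x - \<eta> * 2)"
    by (intro twice_partial_diff f twice_partial_bounded_linear[OF bounded_linear_mult_right] twice_partial_dist_sq)
  let ?B = "PiE {..<n} (\<lambda>j. {a j - r..a j + r})"
  have "a \<in> ?B" using a r by (auto simp: Rn_def PiE_iff)
  moreover have "?g x < ?g a" if x: "x \<in> ?B" "j < n" "x j = a j - r \<or> x j = a j + r" for x j
  proof -
    have "\<eta> * r\<^sup>2 \<le> \<eta> * dist_sq n a x" using box_halfwidth[where a=a and r=r and x=x and j=j, OF x(2,3)] \<eta> by simp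
    moreover have "f x \<le> B" using x(1) box_subset_Rn B by blast
    ultimately show ?thesis using r2 by simp
  qed
  ultimately obtain x where x: "x \<in> ?B" "?g a \<le> ?g x" "(\<Sum>j<n. E j x - \<eta> * 2) \<le> 0"
    by (rule box_interior_max[OF g])
  have "x \<in> Rn n" using x(1) box_subset_Rn by blast
  moreover have "f a \<le> f x" 
  proof -
    have "0 \<le> \<eta> * dist_sq n a x" using \<eta> dist_sq_nonneg by (intro mult_nonneg_nonneg) auto
    then show ?thesis using x(2) by simp
  qed
  ultimately have "\<theta> \<le> (\<Sum>j<n. E j x)" using \<theta>(2) \<open>\<not> f a < \<epsilon>\<close> by simp
  with x(3) \<eta> show False by (simp add: sum_subtractf algebra_simps)
qed

section \<open>Strong maximum principle\<close>

lemma open_contains_cube: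
  assumes "open U" "y \<in> U" "y \<in> Rn n"
  obtains e :: real where "e > 0" "\<And>x. x \<in> Rn n \<Longrightarrow> (\<And>j. j < n \<Longrightarrow> \<bar>x j - y j\<bar> < e) \<Longrightarrow> x \<in> U"
proof -
  obtain X where X: "y \<in> PiE UNIV X" "\<And>i. open (X i)" "PiE UNIV X \<subseteq> U"
    using product_topology_open_contains_basis[of "\<lambda>_. euclidean" UNIV U y] assms
    unfolding euclidean_product_topology by auto
  have "\<exists>e>0. \<forall>t. dist t (y j) < e \<longrightarrow> t \<in> X j" for j
    using X(1) X(2)[of j] by (simp add: open_dist PiE_iff)
  then obtain e where e: "\<And>j. e j > 0" "\<And>j t. dist t (y j) < e j \<Longrightarrow> t \<in> X j"
    by metis
  \<comment> \<open>Points of \<open>Rn n\<close> agree in all coordinates from \<open>n\<close> on,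
    so finitely many radii matter; the inserted 1 keeps \<open>Min\<close> meaningful for
    \<open>n = 0\<close>.\<close>
  define d where "d = Min (insert 1 (e ` {..<n}))"
  have "d > 0" using e(1) by (simp add: d_def)
  moreover have "x \<in> U" if x: "x \<in> Rn n" and xy: "\<And>j. j < n \<Longrightarrow> \<bar>x j - y j\<bar> < d" for x
  proof -
    have "x j \<in> X j" for j
    proof (cases "j < n")
      case True
      then have "d \<le> e j" by (simp add: d_def)
      then show ?thesis using xy[OF True] e(2)[of "x j" j] by (simp add: dist_real_def)
    next
      case False
      then have "x j = y j" using x assms(3) by (simp add: Rn_def PiE_iff extensional_def)
      then show ?thesis using X(1) by (simp add: PiE_iff)
    qed
    then show ?thesis using X(3) by (auto simp: PiE_iff)
  qed
  ultimately show ?thesis by (rule that)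
qed

text \<open>Hopf's barrier \<open>exp (- b \<bar>x - y\<bar>\<^sup>2) - exp (- b r)\<close>, with \<open>b\<close> so large that it is a strict
  subsolution away from \<open>y\<close>. As \<open>r\<close> is arbitrary, no touching ball is needed.\<close>

lemma nonneg_supersolution_pos:
  fixes f :: "(nat \<Rightarrow> real) \<Rightarrow> real"
  assumes f: "twice_partial n f D E"
    and f0: "\<And>x. x \<in> Rn n \<Longrightarrow> 0 \<le> f x"
    and \<Lambda>: "\<Lambda> \<ge> 0" "\<And>x. x \<in> Rn n \<Longrightarrow> (\<Sum>j<n. E j x) \<le> \<Lambda> * f x"
    and y: "y \<in> Rn n" "0 < f y" and z: "z \<in> Rn n"
  shows "0 < f z"
proof (rule ccontr)
  assume "\<not> 0 < f z"
  then have fz: "f z = 0" using f0[OF z] by simp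
  \<comment> \<open>Strictly below \<open>f y\<close>, so that by continuity \<open>f > m\<close>
    near \<open>y\<close>; \<open>m\<close> also bounds the barrier from above.\<close>
  define m where "m = f y / 2"
  have m: "m > 0" "m < f y" using y by (auto simp: m_def)
  obtain U where U: "open U" "f -` {m<..} \<inter> Rn n = U \<inter> Rn n"
    using continuous_on_open_invariant[THEN iffD1, OF twice_partialD(1)[OF f]] open_greaterThan by metis
  have "y \<in> U" using U(2) y m by auto
  then obtain e where e: "e > 0" "\<And>x. x \<in> Rn n \<Longrightarrow> (\<And>j. j < n \<Longrightarrow> \<bar>x j - y j\<bar> < e) \<Longrightarrow> x \<in> U"
    using open_contains_cube[OF U(1) _ y(1)] by metis
  define \<rho> where "\<rho> = e\<^sup>2"
  have \<rho>: "\<rho> > 0" using e by (simp add: \<rho>_def)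
  have near: "m < f x" if x: "x \<in> Rn n" "dist_sq n y x < \<rho>" for x
  proof -
    have "\<bar>x j - y j\<bar> < e" if "j < n" for j
    proof -
      have "(x j - y j)\<^sup>2 < e\<^sup>2" using dist_sq_ge[OF that, of x y] x(2) by (simp add: \<rho>_def)
      then show ?thesis using e(1) by (metis power2_abs power2_less_imp_less less_imp_le)
    qed
    then have "x \<in> U" using e(2) x(1) by blast
    then show ?thesis using U(2) x(1) by auto
  qed
  \<comment> \<open>The second entry gives
    \<open>4 * b * \<rho> - 2 * n \<ge> \<Lambda> + 1\<close>; \<open>b \<ge> 1\<close> then permits
    one more factor \<open>b\<close>, as the Laplacian of the Gaussian demands.\<close>
  define b where "b = max 1 ((2 * n + \<Lambda> + 1) / (4 * \<rho>))"
  have b1: "b \<ge> 1" by (simp add: b_def)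
  have "2 * n + \<Lambda> + 1 \<le> 4 * b * \<rho>"
    using \<rho> by (simp add: b_def field_simps max_def)
  then have b2: "\<Lambda> + 1 \<le> 4 * b * \<rho> - 2 * n" by simp
  have "1 * (4 * b * \<rho> - 2 * n) \<le> b * (4 * b * \<rho> - 2 * n)"
    using b1 b2 \<Lambda>(1) by (intro mult_right_mono) linarith+
  with b2 have b: "\<Lambda> + 1 \<le> 4 * b\<^sup>2 * \<rho> - 2 * n * b"
    by (simp add: power2_eq_square algebra_simps)
  \<comment> \<open>A squared radius: the barrier is positive at \<open>z\<close> and is \<le> 0
    where \<open>dist_sq n y x \<ge> r\<close>. Because \<open>r \<le> r\<^sup>2\<close>, this
    includes the faces of the cube of half width \<open>r\<close>.\<close>
  define r where "r = 1 + dist_sq n y z"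
  have r: "r \<ge> 1" by (simp add: r_def dist_sq_nonneg)
  let ?e = "\<lambda>x. exp (- (b * dist_sq n y x))"
  let ?g = "\<lambda>x. m * (?e x - exp (- (b * r))) - f x"
  have g: "twice_partial n ?g
      (\<lambda>j x. m * (- (2 * b * (x j - y j) * ?e x) - 0) - D j x)
      (\<lambda>j x. m * ((4 * b\<^sup>2 * (x j - y j)\<^sup>2 - 2 * b) * ?e x - 0) - E j x)"
    by (intro twice_partial_diff twice_partial_bounded_linear[OF bounded_linear_mult_right]
        twice_partial_exp_dist_sq twice_partial_const f)
  have gz: "?g z > 0" using m b1 fz by (simp add: r_def)
  have far: "dist_sq n y x < r" if "?g x > 0" "x \<in> Rn n" for x
  proof (rule ccontr)
    assume "\<not> dist_sq n y x < r"
    then have "?e x \<le> exp (- (b * r))" using b1 by simp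
    then have "m * (?e x - exp (- (b * r))) \<le> 0" using m by (simp add: mult_nonneg_nonpos)
    then show False using that f0[OF that(2)] by simp
  qed
  let ?B = "PiE {..<n} (\<lambda>j. {y j - r..y j + r})"
  have "z \<in> ?B"
  proof -
    have "\<bar>z j - y j\<bar> \<le> r" if "j < n" for j
    proof -
      have "(z j - y j)\<^sup>2 \<le> r\<^sup>2"
        using dist_sq_ge[OF that, of z y] r self_le_power[of r 2] by (simp add: r_def)
      then show ?thesis using r by (simp add: abs_le_square_iff[symmetric])
    qed
    then show ?thesis using z by (force simp: PiE_iff Rn_def abs_le_iff)
  qed
  moreover have "?g x < ?g z" if x: "x \<in> ?B" "j < n" "x j = y j - r \<or> x j = y j + r" for x j
  proof -
    have "r \<le> dist_sq n y x" using box_halfwidth[where a=y and r=r and x=x and j=j, OF x(2,3)] self_le_power[of r 2] r by simp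
    moreover have "x \<in> Rn n" using x(1) box_subset_Rn by blast
    ultimately have "?g x \<le> 0" using far[of x] by fastforce
    with gz show ?thesis by simp
  qed
  ultimately obtain x where x: "x \<in> ?B" "?g z \<le> ?g x"
      "(\<Sum>j<n. m * ((4 * b\<^sup>2 * (x j - y j)\<^sup>2 - 2 * b) * ?e x - 0) - E j x) \<le> 0"
    by (rule box_interior_max[OF g])
  have xR: "x \<in> Rn n" using x(1) box_subset_Rn by blast
  have g0: "?g x > 0" using gz x(2) by simp
  \<comment> \<open>At the maximum \<open>f\<close> lies below the barrier and so is at most
    \<open>m\<close>; hence \<open>x\<close> is not near \<open>y\<close>, and the choice of
    \<open>b\<close> takes effect.\<close>
  have fx: "f x \<le> m * ?e x"
    using g0 m by (simp add: right_diff_distrib) (smt (verit) exp_gt_zero mult_pos_pos)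
  also have "\<dots> \<le> m * 1" using m b1 dist_sq_nonneg[of n y x] by (intro mult_left_mono) auto
  finally have "\<not> dist_sq n y x < \<rho>" using near[OF xR] by auto
  then have "4 * b\<^sup>2 * \<rho> \<le> 4 * b\<^sup>2 * dist_sq n y x" by (intro mult_left_mono) auto
  with b have "\<Lambda> + 1 \<le> 4 * b\<^sup>2 * dist_sq n y x - 2 * n * b" by simp
  \<comment> \<open>With e the Gaussian, the chain squeezes \<open>(\<Lambda> + 1) * m * e\<close>
    below the Laplacian of the barrier, that of \<open>f\<close>, and finally
    \<open>\<Lambda> * m * e\<close>.\<close>
  then have "(\<Lambda> + 1) * (m * ?e x) \<le> (4 * b\<^sup>2 * dist_sq n y x - 2 * n * b) * (m * ?e x)"
    using m by (intro mult_right_mono) auto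
  also have "\<dots> = (\<Sum>j<n. m * ((4 * b\<^sup>2 * (x j - y j)\<^sup>2 - 2 * b) * ?e x - 0))"
    by (simp add: dist_sq_def sum_subtractf sum_distrib_left[symmetric] sum_distrib_right[symmetric] algebra_simps)
  also have "\<dots> \<le> (\<Sum>j<n. E j x)" using x(3) by (simp add: sum_subtractf)
  also have "\<dots> \<le> \<Lambda> * (m * ?e x)"
    using \<Lambda>(2)[OF xR] mult_left_mono[OF fx \<Lambda>(1)] by simp
  finally show False using m by (simp add: algebra_simps) (smt (verit) exp_gt_zero mult_pos_pos)
qed

section \<open>Essential bounds of continuous functions\<close>

lemma AE_le_imp_le:
  assumes f: "continuous_on (Rn n) f" and AE: "AE x in lebesgue_n n. f x \<le> (M::real)" and y: "y \<in> Rn n"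
  shows "f y \<le> M"
proof (rule ccontr)
  assume "\<not> f y \<le> M"
  obtain U where U: "open U" "f -` {M<..} \<inter> Rn n = U \<inter> Rn n"
    using continuous_on_open_invariant[THEN iffD1, OF f] open_greaterThan by metis
  have "y \<in> U" using U(2) y \<open>\<not> f y \<le> M\<close> by auto
  then obtain e where e: "e > 0" "\<And>x. x \<in> Rn n \<Longrightarrow> (\<And>j. j < n \<Longrightarrow> \<bar>x j - y j\<bar> < e) \<Longrightarrow> x \<in> U"
    using open_contains_cube[OF U(1) _ y] by metis
  \<comment> \<open>An open cube on which \<open>f\<close> exceeds \<open>M\<close>; its measure
    \<open>(2 * e) ^ n\<close> is positive, against the bound almost everywhere.\<close>
  let ?C = "PiE {..<n} (\<lambda>j. {y j - e<..<y j + e})"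
  interpret product_sigma_finite "\<lambda>_::nat. lborel :: real measure"
    by standard
  have "emeasure (lebesgue_n n) ?C = (\<Prod>j<n. emeasure lborel {y j - e<..<y j + e})"
    unfolding lebesgue_n_def by (rule emeasure_PiM) auto
  also have "\<dots> = ennreal (2 * e) ^ n" using e by simp
  finally have pos: "emeasure (lebesgue_n n) ?C \<noteq> 0" using e by simp
  have C: "?C \<in> sets (lebesgue_n n)" unfolding lebesgue_n_def by (rule sets_PiM_I_finite) auto
  have "AE x in lebesgue_n n. x \<notin> ?C"
    using AE
  proof eventually_elim
    case (elim x)
    show ?case
    proof
      assume x: "x \<in> ?C"
      then have "x \<in> Rn n" using box_subset_Rn by blast
      moreover have "\<bar>x j - y j\<bar> < e" if "j < n" for j
        using x that by (force simp: PiE_iff abs_less_iff)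
      ultimately have "x \<in> U \<inter> Rn n" using e(2) by blast
      then have "x \<in> f -` {M<..} \<inter> Rn n" using U(2) by simp
      with elim show False by simp
    qed
  qed
  then have "?C \<in> null_sets (lebesgue_n n)"
    using C by (simp add: AE_iff_null_sets)
  with pos show False by (simp add: null_sets_def)
qed

section \<open>Translates and increments\<close>

lemma twice_partial_shift:
  assumes "twice_partial n f D E" "i < n"
  shows "twice_partial n (\<lambda>x. f (x(i := x i + h))) (\<lambda>j x. D j (x(i := x i + h)))
    (\<lambda>j x. E j (x(i := x i + h)))"
  using twice_partial_upd_affine[OF assms, of 1 h] by simp

text \<open>The mean value inequality on a coordinate segment. A bounded derivative yields
  increments of order h; a Lipschitz derivative yields a linearization error of order h^2.\<close>

lemma partial_increment:
  assumes f: "twice_partial n f D E" and i: "i < n" and x: "x \<in> Rn n" and h: "0 \<le> h"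
    and L: "\<And>t. 0 \<le> t \<Longrightarrow> t \<le> h \<Longrightarrow> norm (D i (x(i := x i + t)) - D i x) \<le> L"
  shows "norm (f (x(i := x i + h)) - f x - h *\<^sub>R D i x) \<le> h * L"
proof -
  have "norm (f (x(i := x i + h)) - f (x(i := x i)) - (x i + h - x i) *\<^sub>R D i (x(i := x i)))
      \<le> norm (x i + h - x i) * L"
  proof (rule vector_differentiable_bound_linearization[where S="{x i..x i + h}"])
    show "((\<lambda>t. f (x(i := t))) has_vector_derivative D i (x(i := t))) (at t within {x i..x i + h})" for t
      by (rule has_vector_derivative_at_within[OF twice_partial_line[OF f i x]])
    show "norm (D i (x(i := t)) - D i (x(i := x i))) \<le> L" if "t \<in> {x i..x i + h}" for t
      using L[of "t - x i"] that by simp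
  qed (use h in \<open>auto simp: closed_segment_eq_real_ivl\<close>)
  then show ?thesis using h by simp
qed

section \<open>The gradient estimate\<close>

text \<open>On the sphere of radius \<open>R\<close> the radial part of \<open>G\<close> is \<ge> 0
  by continuity from outside. Moving inwards from the sphere to \<open>v\<close> loses at most
  \<open>norm v * \<Lambda> * (R - norm v)\<close>.\<close>

lemma inner_ge_on_ball:
  fixes G :: "'b::real_inner \<Rightarrow> 'b"
  assumes lip: "\<And>v w. norm v \<le> B \<Longrightarrow> norm w \<le> B \<Longrightarrow> norm (G v - G w) \<le> \<Lambda> * norm (v - w)"
    and \<Lambda>: "0 \<le> \<Lambda>" and cont: "continuous_on UNIV G" and R: "R \<le> B"
    and pos: "\<And>v. R < norm v \<Longrightarrow> 0 < v \<bullet> G v" and v: "norm v \<le> R"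
  shows "- (\<Lambda> * (R\<^sup>2 - (norm v)\<^sup>2)) \<le> v \<bullet> G v"
proof (cases "v = 0")
  case True
  then show ?thesis using \<Lambda> by simp
next
  case False
  then have v0: "norm v > 0" by simp
  then have R0: "R > 0" using v by linarith
  \<comment> \<open>The radial projection of \<open>v\<close> to the sphere.\<close>
  define w where "w = (R / norm v) *\<^sub>R v"
  have w: "norm w = R" using v0 R0 by (simp add: w_def)
  have "continuous_on UNIV (\<lambda>t. (t *\<^sub>R w) \<bullet> G (t *\<^sub>R w))"
    by (intro continuous_on_inner continuous_on_compose2[OF cont] continuous_intros) auto
  then have "isCont (\<lambda>t. (t *\<^sub>R w) \<bullet> G (t *\<^sub>R w)) 1"
    by (simp add: continuous_on_eq_continuous_at)
  then have lim: "((\<lambda>t. (t *\<^sub>R w) \<bullet> G (t *\<^sub>R w)) \<longlongrightarrow> w \<bullet> G w) (at_right 1)"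
    by (simp add: isCont_def filterlim_at_split)
  have "eventually (\<lambda>t. 0 \<le> (t *\<^sub>R w) \<bullet> G (t *\<^sub>R w)) (at_right (1::real))"
    using eventually_at_right_less[of 1]
  proof eventually_elim
    case (elim t)
    then have "R < norm (t *\<^sub>R w)" using R0 by (simp add: w)
    then show ?case by (rule less_imp_le[OF pos])
  qed
  then have w0: "0 \<le> w \<bullet> G w"
    using tendsto_lowerbound[OF lim] by simp
  have vw: "v = (norm v / R) *\<^sub>R w" using v0 R0 by (simp add: w_def)
  have "0 \<le> (norm v / R) * (w \<bullet> G w)" using w0 R0 by simp
  also have "\<dots> = v \<bullet> G w" by (subst (2) vw) simp
  finally have 1: "0 \<le> v \<bullet> G w" .
  have "v - w = (1 - R / norm v) *\<^sub>R v" by (simp add: w_def scaleR_diff_left)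
  then have "norm (v - w) = \<bar>(1 - R / norm v) * norm v\<bar>" by (simp add: abs_mult)
  also have "(1 - R / norm v) * norm v = norm v - R" using v0 by (simp add: field_simps)
  finally have vmw: "norm (v - w) = R - norm v" using v by simp
  have "\<bar>v \<bullet> (G v - G w)\<bar> \<le> norm v * norm (G v - G w)" by (rule Cauchy_Schwarz_ineq2)
  also have "\<dots> \<le> norm v * (\<Lambda> * (R - norm v))"
    using lip[of v w] v w R by (intro mult_left_mono) (auto simp: vmw)
  also have "\<dots> \<le> (R + norm v) * (\<Lambda> * (R - norm v))"
    using \<Lambda> v R0 by (intro mult_right_mono) auto
  also have "\<dots> = \<Lambda> * (R\<^sup>2 - (norm v)\<^sup>2)"
    by (simp add: power2_eq_square algebra_simps)
  finally show ?thesis using 1 by (simp add: inner_diff_right)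
qed

text \<open>Strict positivity becomes uniform because the shell between the two radii is
  compact.\<close>

lemma inner_ge_outside_ball:
  fixes G :: "'b::euclidean_space \<Rightarrow> 'b"
  assumes cont: "continuous_on UNIV G"
    and pos: "\<And>v. R < norm v \<Longrightarrow> 0 < v \<bullet> G v" and s: "R\<^sup>2 < s"
  obtains \<delta> where "\<delta> > 0" "\<And>v. norm v \<le> B \<Longrightarrow> s \<le> (norm v)\<^sup>2 \<Longrightarrow> \<delta> \<le> v \<bullet> G v"
proof -
  define K where "K = cball 0 B \<inter> {v::'b. s \<le> (norm v)\<^sup>2}"
  have "compact K" unfolding K_def
    by (intro compact_Int_closed compact_cball closed_Collect_le continuous_intros)
  show ?thesis
  proof (cases "K = {}")
    case True
    then have "1 \<le> v \<bullet> G v" if "norm v \<le> B" "s \<le> (norm v)\<^sup>2" for v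
      using that by (auto simp: K_def)
    then show ?thesis using that[of 1] by simp
  next
    case False
    have "continuous_on K (\<lambda>v. v \<bullet> G v)"
      by (intro continuous_intros continuous_on_subset[OF cont]) auto
    then obtain v where v: "v \<in> K" "\<And>w. w \<in> K \<Longrightarrow> v \<bullet> G v \<le> w \<bullet> G w"
      using continuous_attains_inf[OF \<open>compact K\<close> False] by blast
    have "R\<^sup>2 < (norm v)\<^sup>2" using v(1) s by (auto simp: K_def)
    then have "R < norm v" by (rule power2_less_imp_less) simp
    then have "0 < v \<bullet> G v" by (rule pos)
    moreover have "v \<bullet> G v \<le> w \<bullet> G w" if "norm w \<le> B" "s \<le> (norm w)\<^sup>2" for w
      using v(2)[of w] that by (auto simp: K_def)
    ultimately show ?thesis by (rule that)
  qed
qed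

text \<open>\<open>G\<close> stands for the gradient of \<open>W\<close>. Since \<open>B\<close>
  bounds both \<open>u\<close> and \<open>R\<close>, the Lipschitz condition reaches all values of
  \<open>u\<close> and their radial projections to the sphere of radius \<open>R\<close>.\<close>

locale bounded_solution =
  fixes n :: nat and u :: "(nat \<Rightarrow> real) \<Rightarrow> 'b::euclidean_space" and D E
    and G :: "'b \<Rightarrow> 'b" and B R \<Lambda> :: real
  assumes u: "twice_partial n u D E"
    and eq: "x \<in> Rn n \<Longrightarrow> (\<Sum>j<n. E j x) = G (u x)"
    and bound: "x \<in> Rn n \<Longrightarrow> norm (u x) \<le> B"
    and lip: "norm v \<le> B \<Longrightarrow> norm w \<le> B \<Longrightarrow> norm (G v - G w) \<le> \<Lambda> * norm (v - w)"
    and \<Lambda>: "0 \<le> \<Lambda>" and cont: "continuous_on UNIV G" and R: "0 \<le> R" "R \<le> B"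
    and pos: "R < norm v \<Longrightarrow> 0 < v \<bullet> G v"
begin

lemma partial_bounded:
  obtains L where "L \<ge> 0" "\<And>i x. i < n \<Longrightarrow> x \<in> Rn n \<Longrightarrow> norm (D i x) \<le> L"
proof -
  \<comment> \<open>Bounds the Laplacian \<open>G (u x)\<close> by comparison with
    \<open>G 0\<close>; the summand 1 makes \<open>F\<close> strictly positive.\<close>
  define F where "F = norm (G 0) + \<Lambda> * B + 1"
  have F: "F > 0" using \<Lambda> R by (simp add: F_def add_nonneg_pos)
  have "norm (\<Sum>j<n. E j x) \<le> F" if x: "x \<in> Rn n" for x
  proof -
    have "norm (G (u x) - G 0) \<le> \<Lambda> * norm (u x - 0)" using bound[OF x] R by (intro lip) auto
    also have "\<dots> \<le> \<Lambda> * B" using bound[OF x] \<Lambda> by (intro mult_left_mono) auto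
    finally show ?thesis using norm_triangle_ineq2[of "G (u x)" "G 0"] eq[OF x] by (simp add: F_def)
  qed
  then have "norm (D i x) \<le> 2 * (n * B + F)" if "i < n" "x \<in> Rn n" for i x
    using norm_partial_bound[OF u bound _ F] that by blast
  moreover have "0 \<le> 2 * (n * B + F)" using R F by simp
  ultimately show ?thesis using that by blast
qed

text \<open>A translate minus \<open>u\<close> is of order \<open>h\<close>, and so is its Laplacian since \<open>G\<close> is Lipschitz;
  the interior gradient estimate then replaces Schauder theory.\<close>

lemma partial_lipschitz:
  obtains L where "L \<ge> 0"
    "\<And>i j x h. i < n \<Longrightarrow> j < n \<Longrightarrow> x \<in> Rn n \<Longrightarrow> 0 \<le> h \<Longrightarrow> norm (D j (x(i := x i + h)) - D j x) \<le> L * h"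
proof -
  obtain L where L: "L \<ge> 0" "\<And>i x. i < n \<Longrightarrow> x \<in> Rn n \<Longrightarrow> norm (D i x) \<le> L"
    by (rule partial_bounded) blast
  \<comment> \<open>One \<open>L * h\<close> is the linear term, the other two come from the crude
    oscillation bound \<open>2 * L\<close> of the derivative.\<close>
  have 1: "norm (u (x(i := x i + h)) - u x) \<le> 3 * L * h" if i: "i < n" and x: "x \<in> Rn n" and h: "h > 0" for i x h
  proof -
    have "norm (u (x(i := x i + h)) - u x - h *\<^sub>R D i x) \<le> h * (2 * L)"
    proof (rule partial_increment[OF u i x])
      fix t
      show "norm (D i (x(i := x i + t)) - D i x) \<le> 2 * L"
        using norm_triangle_ineq4[of "D i (x(i := x i + t))" "D i x"] L(2)[OF i x] L(2)[OF i Rn_upd[OF x i]]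
        by (smt (verit))
    qed (use h in auto)
    moreover have "norm (h *\<^sub>R D i x) \<le> h * L" using h L(2)[OF i x] by simp
    ultimately have "norm (u (x(i := x i + h)) - u x) \<le> h * L + h * (2 * L)"
      using norm_triangle_sub[of "u (x(i := x i + h)) - u x" "h *\<^sub>R D i x"] by linarith
    then show ?thesis by (simp add: algebra_simps)
  qed
  \<comment> \<open>The constant of \<open>norm_partial_bound\<close> for the increment of
    \<open>u\<close>, with the common factor \<open>h\<close> taken out.\<close>
  define K where "K = 2 * (n * (3 * L) + (\<Lambda> * (3 * L) + 1))"
  have "norm (D j (x(i := x i + h)) - D j x) \<le> K * h"
    if i: "i < n" and j: "j < n" and x: "x \<in> Rn n" and h: "h > 0" for i j x h
  proof -
    have "norm (D j (x(i := x i + h)) - D j x) \<le> 2 * (n * (3 * L * h) + (\<Lambda> * (3 * L) + 1) * h)"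
    proof (rule norm_partial_bound[OF twice_partial_diff[OF twice_partial_shift[OF u i] u] _ _ _ j x])
      fix y assume y: "y \<in> Rn n"
      show "norm (u (y(i := y i + h)) - u y) \<le> 3 * L * h" by (rule 1[OF i y h])
      have yR: "y(i := y i + h) \<in> Rn n" using y i by (rule Rn_upd)
      have "norm (\<Sum>j<n. E j (y(i := y i + h)) - E j y) = norm (G (u (y(i := y i + h))) - G (u y))"
        using eq[OF yR] eq[OF y] by (simp add: sum_subtractf)
      also have "\<dots> \<le> \<Lambda> * norm (u (y(i := y i + h)) - u y)" by (intro lip bound y yR)
      also have "\<dots> \<le> \<Lambda> * (3 * L * h)" by (intro mult_left_mono 1 i y h \<Lambda>)
      also have "\<dots> \<le> (\<Lambda> * (3 * L) + 1) * h" using h by (simp add: algebra_simps)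
      finally show "norm (\<Sum>j<n. E j (y(i := y i + h)) - E j y) \<le> (\<Lambda> * (3 * L) + 1) * h" .
    next
      show "0 < (\<Lambda> * (3 * L) + 1) * h" using h \<Lambda> L(1) by (intro mult_pos_pos) (auto simp: add_nonneg_pos)
    qed
    then show ?thesis by (simp add: K_def algebra_simps)
  qed
  then have "norm (D j (x(i := x i + h)) - D j x) \<le> K * h"
    if "i < n" "j < n" "x \<in> Rn n" "0 \<le> h" for i j x h
    using that by (cases "h = 0") auto
  moreover have "K \<ge> 0" using L(1) \<Lambda> by (simp add: K_def)
  ultimately show ?thesis using that by blast
qed

definition quot :: "real \<Rightarrow> nat \<Rightarrow> (nat \<Rightarrow> real) \<Rightarrow> 'b"
  where "quot h i x = (1 / h) *\<^sub>R (u (x(i := x i + h)) - u x)"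

text \<open>The Lipschitz bound on \<open>D\<close> makes the error O(h) uniformly on the whole
  space. One constant, the sum of the two bounds, serves both claims.\<close>

lemma quot_approx:
  obtains L where "L \<ge> 0" "\<And>i x. i < n \<Longrightarrow> x \<in> Rn n \<Longrightarrow> norm (D i x) \<le> L"
    "\<And>i x h. i < n \<Longrightarrow> x \<in> Rn n \<Longrightarrow> 0 < h \<Longrightarrow> norm (quot h i x - D i x) \<le> L * h"
proof -
  obtain L1 where L1: "L1 \<ge> 0" "\<And>i x. i < n \<Longrightarrow> x \<in> Rn n \<Longrightarrow> norm (D i x) \<le> L1"
    by (rule partial_bounded) blast
  obtain L2 where L2: "L2 \<ge> 0" "\<And>i j x h. i < n \<Longrightarrow> j < n \<Longrightarrow> x \<in> Rn n \<Longrightarrow> 0 \<le> h \<Longrightarrow>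
      norm (D j (x(i := x i + h)) - D j x) \<le> L2 * h"
    by (rule partial_lipschitz) blast
  have "norm (quot h i x - D i x) \<le> (L1 + L2) * h" if i: "i < n" and x: "x \<in> Rn n" and h: "0 < h" for i x h
  proof -
    have "norm (u (x(i := x i + h)) - u x - h *\<^sub>R D i x) \<le> h * (L2 * h)" (is "norm ?d \<le> _")
    proof (rule partial_increment[OF u i x])
      fix t assume t: "0 \<le> t" "t \<le> h"
      have "L2 * t \<le> L2 * h" using t L2(1) by (intro mult_left_mono) auto
      then show "norm (D i (x(i := x i + t)) - D i x) \<le> L2 * h"
        using L2(2)[OF i i x t(1)] by simp
    qed (use h in auto)
    then have "1 / h * norm ?d \<le> 1 / h * (h * (L2 * h))"
      using h by (intro mult_left_mono) auto
    moreover have "quot h i x - D i x = (1 / h) *\<^sub>R ?d"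
      using h by (simp add: quot_def scaleR_diff_right)
    ultimately have "norm (quot h i x - D i x) \<le> L2 * h" using h by simp
    moreover have "0 \<le> L1 * h" using L1(1) h by simp
    ultimately show ?thesis by (simp add: distrib_right)
  qed
  moreover have "norm (D i x) \<le> L1 + L2" if "i < n" "x \<in> Rn n" for i x
    using L1(2)[OF that] L2(1) by simp
  ultimately show ?thesis using that[of "L1 + L2"] L1(1) L2(1) by simp
qed

text \<open>The functional is P plus the constant C R^2, with quotients for derivatives. The
  Laplacian of a quotient is the quotient of \<open>G\<close> along \<open>u\<close>, at most
  \<open>\<Lambda>\<close> times its norm; the squared derivatives of the quotients are
  dropped.\<close>

lemma quot_functional:
  assumes h: "h > 0" and C: "C \<ge> 0"
  obtains D' E' where
    "twice_partial n (\<lambda>x. (\<Sum>i<n. 1/2 * (norm (quot h i x))\<^sup>2) + 2 * C * (1/2 * (norm (u x))\<^sup>2)) D' E'"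
    "\<And>x. x \<in> Rn n \<Longrightarrow> - (\<Lambda> * (\<Sum>i<n. (norm (quot h i x))\<^sup>2))
        + 2 * C * ((\<Sum>j<n. (norm (D j x))\<^sup>2) + u x \<bullet> G (u x)) \<le> (\<Sum>j<n. E' j x)"
proof -
  define d where "d = (\<lambda>i j x. (1 / h) *\<^sub>R (D j (x(i := x i + h)) - D j x))"
  define e where "e = (\<lambda>i j x. (1 / h) *\<^sub>R (E j (x(i := x i + h)) - E j x))"
  have q: "twice_partial n (quot h i) (d i) (e i)" if "i \<in> {..<n}" for i
    unfolding quot_def d_def e_def using that
    by (intro twice_partial_bounded_linear[OF bounded_linear_scaleR_right] twice_partial_diff
        twice_partial_shift u) auto
  \<comment> \<open>The derivatives of the functional are never written out; unification supplies
    the witnesses.\<close>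
  note tp = twice_partial_add[OF twice_partial_sum[OF twice_partial_half_norm_sq[OF q]]
      twice_partial_bounded_linear[OF bounded_linear_mult_right[of "2 * C"] twice_partial_half_norm_sq[OF u]]]
  show ?thesis
  proof (rule that[OF tp])
    fix x assume x: "x \<in> Rn n"
    have 1: "- (\<Lambda> * (norm (quot h i x))\<^sup>2) \<le> (\<Sum>j<n. (norm (d i j x))\<^sup>2 + quot h i x \<bullet> e i j x)"
      if i: "i < n" for i
    proof -
      let ?y = "x(i := x i + h)"
      have y: "?y \<in> Rn n" using x i by (rule Rn_upd)
      have "(\<Sum>j<n. e i j x) = (1 / h) *\<^sub>R (G (u ?y) - G (u x))"
        by (simp add: e_def scaleR_sum_right[symmetric] sum_subtractf eq[OF x] eq[OF y])
      moreover have "norm (G (u ?y) - G (u x)) \<le> \<Lambda> * norm (u ?y - u x)"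
        by (intro lip bound x y)
      ultimately have "norm (\<Sum>j<n. e i j x) \<le> \<Lambda> * norm (quot h i x)"
        using h by (simp add: quot_def divide_right_mono)
      then have "norm (quot h i x) * norm (\<Sum>j<n. e i j x) \<le> norm (quot h i x) * (\<Lambda> * norm (quot h i x))"
        by (intro mult_left_mono) auto
      then have "\<bar>quot h i x \<bullet> (\<Sum>j<n. e i j x)\<bar> \<le> \<Lambda> * (norm (quot h i x))\<^sup>2"
        using Cauchy_Schwarz_ineq2[of "quot h i x" "\<Sum>j<n. e i j x"]
        by (simp add: power2_eq_square algebra_simps)
      moreover have "0 \<le> (\<Sum>j<n. (norm (d i j x))\<^sup>2)" by (simp add: sum_nonneg)
      ultimately show ?thesis by (simp add: sum.distrib inner_sum_right)
    qed
    have "- (\<Lambda> * (\<Sum>i<n. (norm (quot h i x))\<^sup>2)) = (\<Sum>i<n. - (\<Lambda> * (norm (quot h i x))\<^sup>2))"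
      by (simp add: sum_distrib_left sum_negf)
    also have "\<dots> \<le> (\<Sum>i<n. \<Sum>j<n. (norm (d i j x))\<^sup>2 + quot h i x \<bullet> e i j x)"
      by (intro sum_mono 1) auto
    also have "\<dots> = (\<Sum>j<n. \<Sum>i<n. (norm (d i j x))\<^sup>2 + quot h i x \<bullet> e i j x)"
      by (rule sum.swap)
    finally have 2: "- (\<Lambda> * (\<Sum>i<n. (norm (quot h i x))\<^sup>2)) \<le> \<dots>" .
    have 3: "(\<Sum>j<n. 2 * C * ((norm (D j x))\<^sup>2 + u x \<bullet> E j x))
        = 2 * C * ((\<Sum>j<n. (norm (D j x))\<^sup>2) + u x \<bullet> G (u x))"
      by (simp add: sum_distrib_left[symmetric] sum.distrib inner_sum_right[symmetric] eq[OF x])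
    show "- (\<Lambda> * (\<Sum>i<n. (norm (quot h i x))\<^sup>2))
        + 2 * C * ((\<Sum>j<n. (norm (D j x))\<^sup>2) + u x \<bullet> G (u x))
        \<le> (\<Sum>j<n. (\<Sum>i<n. (norm (d i j x))\<^sup>2 + quot h i x \<bullet> e i j x) + 2 * C * ((norm (D j x))\<^sup>2 + u x \<bullet> E j x))"
      unfolding sum.distrib[of "\<lambda>j. \<Sum>i<n. (norm (d i j x))\<^sup>2 + quot h i x \<bullet> e i j x"] 3
      using 2 by (rule add_right_mono)
  qed
qed

text \<open>The derivative bounds, which depend on \<open>n\<close>, only make P bounded and
  determine the step \<open>h\<close>. They leave no trace in the constant.\<close>

lemma gradient_estimate:
  assumes x0: "x0 \<in> Rn n"
  shows "1/2 * (\<Sum>j<n. (norm (D j x0))\<^sup>2) \<le> (\<Lambda> + 1) * (R\<^sup>2 - (norm (u x0))\<^sup>2)"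
proof -
  define C where "C = \<Lambda> + 1"
  have C: "C \<ge> 1" "C > 0" using \<Lambda> by (auto simp: C_def)
  obtain L where L: "L \<ge> 0" "\<And>i x. i < n \<Longrightarrow> x \<in> Rn n \<Longrightarrow> norm (D i x) \<le> L"
    "\<And>i x h. i < n \<Longrightarrow> x \<in> Rn n \<Longrightarrow> 0 < h \<Longrightarrow> norm (quot h i x - D i x) \<le> L * h"
    by (rule quot_approx) blast
  define A where "A = (\<lambda>h x. \<Sum>i<n. (norm (quot h i x))\<^sup>2)"
  define S where "S = (\<lambda>x. \<Sum>j<n. (norm (D j x))\<^sup>2)"
  \<comment> \<open>Each difference of squares factors into a difference \<le> \<open>L * h\<close>
    and a sum \<le> \<open>2 * L + L\<close>.\<close>
  define k where "k = n * (L * (3 * L))"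
  have k: "k \<ge> 0" using L(1) by (simp add: k_def)
  have quot_le: "norm (quot h i x) \<le> 2 * L" if "i < n" "x \<in> Rn n" "0 < h" "h \<le> 1" for i x h
  proof -
    have "L * h \<le> L * 1" using that L(1) by (intro mult_left_mono) auto
    then show ?thesis using norm_triangle_sub[of "quot h i x" "D i x"] L(2,3) that by fastforce
  qed
  have A_le: "A h x \<le> n * (2 * L)\<^sup>2" if "x \<in> Rn n" "0 < h" "h \<le> 1" for x h
  proof -
    have "A h x \<le> (\<Sum>i<n. (2 * L)\<^sup>2)"
      unfolding A_def using quot_le that by (intro sum_mono power_mono) auto
    then show ?thesis by simp
  qed
  have AS: "\<bar>A h x - S x\<bar> \<le> k * h" if x: "x \<in> Rn n" and h: "0 < h" "h \<le> 1" for x h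
  proof -
    have "\<bar>A h x - S x\<bar> \<le> (\<Sum>i<n. \<bar>(norm (quot h i x))\<^sup>2 - (norm (D i x))\<^sup>2\<bar>)"
      unfolding A_def S_def sum_subtractf[symmetric] by (rule sum_abs)
    also have "\<dots> \<le> (\<Sum>i<n. (L * h) * (3 * L))"
    proof (rule sum_mono)
      fix i assume "i \<in> {..<n}"
      then have i: "i < n" by simp
      have "(norm (quot h i x))\<^sup>2 - (norm (D i x))\<^sup>2
          = (norm (quot h i x) - norm (D i x)) * (norm (quot h i x) + norm (D i x))"
        by (simp add: power2_eq_square algebra_simps)
      then have "\<bar>(norm (quot h i x))\<^sup>2 - (norm (D i x))\<^sup>2\<bar>
          = \<bar>norm (quot h i x) - norm (D i x)\<bar> * (norm (quot h i x) + norm (D i x))"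
        by (simp add: abs_mult)
      also have "\<dots> \<le> (L * h) * (3 * L)"
        using norm_triangle_ineq3[of "quot h i x" "D i x"] L(3)[OF i x h(1)] quot_le[OF i x h] L(2)[OF i x] L(1) h
        by (intro mult_mono) auto
      finally show "\<bar>(norm (quot h i x))\<^sup>2 - (norm (D i x))\<^sup>2\<bar> \<le> (L * h) * (3 * L)" .
    qed
    also have "\<dots> = k * h" by (simp add: k_def)
    finally show ?thesis .
  qed
  have "1/2 * S x0 + C * (norm (u x0))\<^sup>2 - C * R\<^sup>2 \<le> 0"
  proof (rule field_le_epsilon)
    fix \<epsilon>' :: real assume "\<epsilon>' > 0"
    \<comment> \<open>One half goes to the maximum principle, the other covers the return from
      quotients to derivatives at \<open>x0\<close>.\<close>
    define \<epsilon> where "\<epsilon> = \<epsilon>' / 2"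
    have \<epsilon>: "\<epsilon> > 0" using \<open>\<epsilon>' > 0\<close> by (simp add: \<epsilon>_def)
    obtain \<delta> where \<delta>: "\<delta> > 0"
        "\<And>v. norm v \<le> B \<Longrightarrow> R\<^sup>2 + \<epsilon> / (2 * C) \<le> (norm v)\<^sup>2 \<Longrightarrow> \<delta> \<le> v \<bullet> G v"
      using inner_ge_outside_ball[OF cont pos, of R "R\<^sup>2 + \<epsilon> / (2 * C)" B] \<epsilon> C by auto
    \<comment> \<open>The two entries are the two sources of positivity outside the ball: large
      quotients, or the radial part of \<open>G\<close>.\<close>
    define \<theta> where "\<theta> = min \<epsilon> (C * \<delta>)"
    have \<theta>: "\<theta> > 0" "\<theta> \<le> \<epsilon>" "\<theta> \<le> C * \<delta>" using \<epsilon> \<delta>(1) C by (auto simp: \<theta>_def)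
    \<comment> \<open>Small enough for \<open>2 * C * (k * h) \<le> \<theta>\<close>;
      \<open>k + 1\<close> avoids division by zero.\<close>
    define h where "h = min 1 (\<theta> / (2 * C * (k + 1)))"
    have h: "0 < h" "h \<le> 1" using \<theta> C k by (auto simp: h_def)
    have "2 * C * (k + 1) * h \<le> 2 * C * (k + 1) * (\<theta> / (2 * C * (k + 1)))"
      using C k by (intro mult_left_mono) (auto simp: h_def)
    also have "\<dots> = \<theta>" using C k by simp
    finally have "2 * C * (k * h) + 2 * C * h \<le> \<theta>" by (simp add: algebra_simps)
    then have kh: "2 * C * (k * h) \<le> \<theta>" using C h by (smt (verit) mult_pos_pos)
    define P where "P = (\<lambda>x. (\<Sum>i<n. 1/2 * (norm (quot h i x))\<^sup>2) + 2 * C * (1/2 * (norm (u x))\<^sup>2))"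
    have P: "P x = 1/2 * A h x + C * (norm (u x))\<^sup>2" for x
      by (simp add: P_def A_def sum_distrib_left)
    obtain D' E' where D': "twice_partial n P D' E'" and
        E': "\<And>x. x \<in> Rn n \<Longrightarrow> - (\<Lambda> * A h x) + 2 * C * (S x + u x \<bullet> G (u x)) \<le> (\<Sum>j<n. E' j x)"
      using quot_functional[OF h(1), of C] C unfolding P_def A_def S_def by auto
    have "P x0 < C * R\<^sup>2 + \<epsilon>"
    proof (rule bounded_subsolution_less[OF D' _ \<theta>(1) _ x0])
      fix x assume x: "x \<in> Rn n"
      have "(norm (u x))\<^sup>2 \<le> B\<^sup>2" using bound[OF x] by (intro power_mono) auto
      then show "P x \<le> 1/2 * (n * (2 * L)\<^sup>2) + C * B\<^sup>2"
        unfolding P using A_le[OF x h] C by (intro add_mono mult_left_mono) auto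
      have A0: "0 \<le> A h x" by (simp add: A_def sum_nonneg)
      have "A h x - S x \<le> k * h" using AS[OF x h] by simp
      then have "2 * C * (A h x - k * h) \<le> 2 * C * S x" using C by (intro mult_left_mono) auto
      then have main: "(2 * C - \<Lambda>) * A h x - \<theta> + 2 * C * (u x \<bullet> G (u x)) \<le> (\<Sum>j<n. E' j x)"
        using E'[OF x] kh by (simp add: algebra_simps)
      have \<Lambda>A: "0 \<le> \<Lambda> * A h x" using \<Lambda> A0 by simp
      assume le: "C * R\<^sup>2 + \<epsilon> \<le> P x"
      define Q where "Q = C * (R\<^sup>2 - (norm (u x))\<^sup>2)"
      have C2: "2 * C - \<Lambda> = 2 + \<Lambda>" by (simp add: C_def)
      \<comment> \<open>One \<open>\<theta>\<close> pays for replacing \<open>S\<close> by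
        \<open>A\<close> in \<open>main\<close>, the other remains.\<close>
      have "\<theta> + \<theta> \<le> (2 * C - \<Lambda>) * A h x + 2 * C * (u x \<bullet> G (u x))"
      proof (cases "norm (u x) \<le> R")
        case True
        have "- (\<Lambda> * (R\<^sup>2 - (norm (u x))\<^sup>2)) \<le> u x \<bullet> G (u x)"
          by (rule inner_ge_on_ball[OF lip \<Lambda> cont R(2) pos True])
        then have "C * - (\<Lambda> * (R\<^sup>2 - (norm (u x))\<^sup>2)) \<le> C * (u x \<bullet> G (u x))"
          using C by (intro mult_left_mono) auto
        then have 1: "- (\<Lambda> * Q) \<le> C * (u x \<bullet> G (u x))" by (simp add: Q_def mult_ac)
        \<comment> \<open>This is \<open>le\<close> rearranged. With \<open>Q \<ge> 0\<close> it
          gives \<open>A h x \<ge> 2 * \<epsilon>\<close>, while the possible loss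
          \<open>2 * \<Lambda> * Q\<close> is absorbed by \<open>\<Lambda> * A h x\<close>.\<close>
        have QA: "Q \<le> 1/2 * A h x - \<epsilon>"
          using le by (simp add: P Q_def algebra_simps)
        then have 2: "\<Lambda> * Q \<le> \<Lambda> * (1/2 * A h x) - \<Lambda> * \<epsilon>"
          unfolding right_diff_distrib[symmetric] using \<Lambda> by (rule mult_left_mono)
        have "0 \<le> Q"
          using True C by (simp add: Q_def power_mono)
        moreover have "0 \<le> \<Lambda> * \<epsilon>" using \<Lambda> \<epsilon> by simp
        ultimately have "\<theta> + \<theta> \<le> 2 * A h x + \<Lambda> * A h x + 2 * (C * (u x \<bullet> G (u x)))"
          using \<theta>(2) \<epsilon> QA 1 2 by simp
        then show ?thesis unfolding C2 by (simp add: algebra_simps)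
      next
        case False
        then have pos': "0 < u x \<bullet> G (u x)" by (intro pos) simp
        show ?thesis
        proof (cases "\<epsilon> \<le> A h x")
          case True
          have "0 < C * (u x \<bullet> G (u x))" using C pos' by simp
          then show ?thesis using True \<theta>(2) \<Lambda>A by (simp add: C_def algebra_simps)
        next
          case False
          \<comment> \<open>When the quotients contribute less than \<open>\<epsilon> / 2\<close> to
            P, the rest must come from \<open>u\<close>, which puts \<open>u x\<close> into the
            shell where \<open>\<delta>\<close> applies.\<close>
          then have "C * (R\<^sup>2 + \<epsilon> / (2 * C)) \<le> C * (norm (u x))\<^sup>2"
            using le C by (simp add: P algebra_simps)
          then have "R\<^sup>2 + \<epsilon> / (2 * C) \<le> (norm (u x))\<^sup>2" using C by simp
          then have "C * \<delta> \<le> C * (u x \<bullet> G (u x))" using \<delta>(2) bound[OF x] C by simp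
          then show ?thesis using \<theta>(3) A0 \<Lambda>A by (simp add: C_def algebra_simps)
        qed
      qed
      with main show "\<theta> \<le> (\<Sum>j<n. E' j x)" by simp
    qed
    moreover have "S x0 \<le> A h x0 + k * h" using AS[OF x0 h] by simp
    moreover have "k * h \<le> C * (k * h)" using C k h mult_right_mono[of 1 C "k * h"] by simp
    ultimately show "1/2 * S x0 + C * (norm (u x0))\<^sup>2 - C * R\<^sup>2 \<le> 0 + \<epsilon>'"
      using kh \<theta>(2) \<epsilon> unfolding P by (simp add: \<epsilon>_def)
  qed
  then show ?thesis by (simp add: S_def C_def algebra_simps)
qed

end

section \<open>Strict inequality for nonconstant solutions\<close>

lemma zero_partials_imp_eq:
  assumes u: "twice_partial n u D E" and D: "\<And>j x. j < n \<Longrightarrow> x \<in> Rn n \<Longrightarrow> D j x = 0"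
    and x: "x \<in> Rn n" and y: "y \<in> Rn n"
  shows "u x = u y"
proof -
  \<comment> \<open>The first \<open>k\<close> coordinates come from \<open>y\<close>, the others
    from \<open>x\<close>; each step from \<open>k\<close> to \<open>k + 1\<close> moves along one
    coordinate line.\<close>
  define z where "z = (\<lambda>k j. if j < k then y j else x j)"
  have zR: "z k \<in> Rn n" for k
    using x y by (auto simp: z_def Rn_def PiE_iff extensional_def)
  have "k \<le> n \<Longrightarrow> u (z k) = u x" for k
  proof (induction k)
    case 0
    then show ?case by (simp add: z_def)
  next
    case (Suc k)
    have k: "k < n" using Suc(2) by simp
    have "((\<lambda>t. u ((z k)(k := t))) has_vector_derivative 0) (at t within UNIV)" for t
      using twice_partial_line[OF u k zR[of k], of t] D[OF k Rn_upd[OF zR[of k] k, of t]] by simp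
    then obtain c where c: "\<And>t. u ((z k)(k := t)) = c"
      using has_vector_derivative_zero_constant[of UNIV "\<lambda>t. u ((z k)(k := t))"] by auto
    have "z (Suc k) = (z k)(k := y k)" by (auto simp: z_def less_Suc_eq)
    then have "u (z (Suc k)) = u (z k)" using c[of "y k"] c[of "z k k"] by simp
    then show ?case using Suc by simp
  qed
  from this[of n] have "u (z n) = u x" by simp
  moreover have "z n = y" using x y by (auto simp: z_def Rn_def PiE_iff extensional_def)
  ultimately show ?thesis by simp
qed

context bounded_solution
begin

lemma norm_le_R:
  assumes "x \<in> Rn n"
  shows "norm (u x) \<le> R"
proof -
  have "0 \<le> 1/2 * (\<Sum>j<n. (norm (D j x))\<^sup>2)" by (simp add: sum_nonneg)
  then have "0 \<le> (\<Lambda> + 1) * (R\<^sup>2 - (norm (u x))\<^sup>2)" using gradient_estimate[OF assms] by linarith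
  then have "(norm (u x))\<^sup>2 \<le> R\<^sup>2" using \<Lambda> by (simp add: zero_le_mult_iff)
  then show ?thesis using R(1) by (rule power2_le_imp_le)
qed

lemma norm_less_R:
  assumes nc: "\<not> u constant_on Rn n" and z: "z \<in> Rn n"
  shows "norm (u z) < R"
proof -
  define f where "f = (\<lambda>x. R\<^sup>2 - 2 * (1/2 * (norm (u x))\<^sup>2))"
  have tp: "twice_partial n f (\<lambda>j x. 0 - 2 * (u x \<bullet> D j x)) (\<lambda>j x. 0 - 2 * ((norm (D j x))\<^sup>2 + u x \<bullet> E j x))"
    unfolding f_def
    by (intro twice_partial_diff twice_partial_const
        twice_partial_bounded_linear[OF bounded_linear_mult_right] twice_partial_half_norm_sq u)
  have f0: "0 \<le> f x" if "x \<in> Rn n" for x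
    using norm_le_R[OF that] by (simp add: f_def power_mono)
  have lap: "(\<Sum>j<n. 0 - 2 * ((norm (D j x))\<^sup>2 + u x \<bullet> E j x)) \<le> 2 * \<Lambda> * f x" if x: "x \<in> Rn n" for x
  proof -
    have "(\<Sum>j<n. 0 - 2 * ((norm (D j x))\<^sup>2 + u x \<bullet> E j x))
        = - 2 * (\<Sum>j<n. (norm (D j x))\<^sup>2) - 2 * (u x \<bullet> G (u x))"
      by (simp add: sum_negf sum_subtractf sum_distrib_left[symmetric] inner_sum_right[symmetric] eq[OF x])
    moreover have "- (\<Lambda> * (R\<^sup>2 - (norm (u x))\<^sup>2)) \<le> u x \<bullet> G (u x)"
      by (rule inner_ge_on_ball[OF lip \<Lambda> cont R(2) pos norm_le_R[OF x]])
    moreover have "0 \<le> (\<Sum>j<n. (norm (D j x))\<^sup>2)" by (simp add: sum_nonneg)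
    ultimately show ?thesis by (simp add: f_def)
  qed
  \<comment> \<open>If \<open>f\<close> vanished identically, the gradient estimate would annihilate
    all partial derivatives and \<open>u\<close> would be constant.\<close>
  have "\<exists>y\<in>Rn n. 0 < f y"
  proof (rule ccontr)
    assume "\<not> (\<exists>y\<in>Rn n. 0 < f y)"
    have "D j x = 0" if j: "j < n" and x: "x \<in> Rn n" for j x
    proof -
      have "R\<^sup>2 - (norm (u x))\<^sup>2 = 0"
        using f0[OF x] \<open>\<not> (\<exists>y\<in>Rn n. 0 < f y)\<close> x by (force simp: f_def)
      then have "(\<Sum>j<n. (norm (D j x))\<^sup>2) \<le> 0" using gradient_estimate[OF x] by simp
      moreover have "(norm (D j x))\<^sup>2 \<le> (\<Sum>j<n. (norm (D j x))\<^sup>2)"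
        using j by (intro member_le_sum) auto
      ultimately have "(norm (D j x))\<^sup>2 \<le> 0" by linarith
      then show ?thesis by simp
    qed
    then have "u constant_on Rn n"
      using zero_partials_imp_eq[OF u] unfolding constant_on_def by metis
    with nc show False by contradiction
  qed
  then obtain y where y: "y \<in> Rn n" "0 < f y" by blast
  have "0 < f z"
    by (rule nonneg_supersolution_pos[OF tp f0 _ lap y z]) (use \<Lambda> in auto)
  then show ?thesis using R(1) by (simp add: f_def power2_less_imp_less)
qed

end

section \<open>Constants from \<open>W\<close> and conclusion\<close>

lemma C2_holder_grad_lipschitz:
  fixes W :: "real ^ 'm \<Rightarrow> real"
  assumes W: "C2_holder \<alpha> W" and \<alpha>: "0 < \<alpha>" and B: "0 \<le> B"
  obtains \<Lambda> where "\<Lambda> \<ge> 0"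
    "\<And>v w. norm v \<le> B \<Longrightarrow> norm w \<le> B \<Longrightarrow> norm (grad W v - grad W w) \<le> \<Lambda> * norm (v - w)"
proof -
  let ?J = "\<lambda>v. jacobian (grad W) (at v)"
  obtain L where L: "\<And>v w. v \<in> cball 0 B \<Longrightarrow> w \<in> cball 0 B \<Longrightarrow> norm (?J v - ?J w) \<le> L * norm (v - w) powr \<alpha>"
    using W compact_cball unfolding C2_holder_def by metis
  \<comment> \<open>The Hoelder condition bounds the Hessian on the ball in terms of its value at 0;
    the absolute value allows for a negative \<open>L\<close>. The mean value inequality on the
    convex ball then applies.\<close>
  define N where "N = norm (?J 0) + \<bar>L\<bar> * B powr \<alpha>"
  have N: "norm (?J v) \<le> N" if v: "v \<in> cball 0 B" for v
  proof -
    have "norm (?J v - ?J 0) \<le> L * norm v powr \<alpha>" using L[OF v, of 0] B by simp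
    also have "\<dots> \<le> \<bar>L\<bar> * B powr \<alpha>"
      using v \<alpha> by (intro mult_mono powr_mono2) auto
    finally show ?thesis using norm_triangle_ineq2[of "?J v" "?J 0"] by (simp add: N_def)
  qed
  have N0: "N \<ge> 0" by (simp add: N_def)
  define \<Lambda> where "\<Lambda> = real CARD('m) * real CARD('m) * N"
  have "norm (grad W v - grad W w) \<le> \<Lambda> * norm (v - w)" if "norm v \<le> B" "norm w \<le> B" for v w
  proof (rule differentiable_bound[of "cball 0 B"])
    fix v :: "real ^ 'm" assume v: "v \<in> cball 0 B"
    have "grad W differentiable (at v)" using W by (simp add: C2_holder_def)
    then show "(grad W has_derivative (\<lambda>h. ?J v *v h)) (at v within cball 0 B)"
      unfolding jacobian_works by (rule has_derivative_at_withinI)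
    have "\<bar>?J v $ i $ j\<bar> \<le> N" for i j
      using component_le_norm_cart[of "?J v $ i" j] Finite_Cartesian_Product.norm_nth_le[of "?J v" i] N[OF v] by linarith
    then show "onorm (\<lambda>h. ?J v *v h) \<le> \<Lambda>"
      unfolding \<Lambda>_def by (rule onorm_le_matrix_component)
  qed (use that in auto)
  moreover have "\<Lambda> \<ge> 0" using N0 by (simp add: \<Lambda>_def)
  ultimately show ?thesis using that by blast
qed

lemma Ck_2_twice_partial:
  assumes "Ck n 2 u"
  shows "twice_partial n u (\<lambda>i. partial i u) (\<lambda>i. partial i (partial i u))"
proof (rule twice_partialI)
  have C: "continuous_on (Rn n) u" "\<And>i x. i < n \<Longrightarrow> x \<in> Rn n \<Longrightarrow> (\<lambda>t. u (x(i := t))) differentiable (at (x i))"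
    "\<And>i x. i < n \<Longrightarrow> x \<in> Rn n \<Longrightarrow> (\<lambda>t. partial i u (x(i := t))) differentiable (at (x i))"
    using assms by (auto simp: numeral_2_eq_2)
  show "continuous_on (Rn n) u" by (rule C)
  fix j x assume jx: "j < n" "x \<in> Rn n"
  show "((\<lambda>t. u (x(j := t))) has_vector_derivative partial j u x) (at (x j))"
    using C(2)[OF jx] unfolding partial_def vector_derivative_works .
  show "((\<lambda>t. partial j u (x(j := t))) has_vector_derivative partial j (partial j u) x) (at (x j))"
    using C(3)[OF jx] unfolding partial_def[of _ "partial j u"] vector_derivative_works .
qed

lemma Linf_norm_imp_bounded:
  assumes "continuous_on (Rn n) u" "Linf_norm n u = ereal M" "x \<in> Rn n"
  shows "norm (u x) \<le> M"
proof (rule AE_le_imp_le[OF _ _ assms(3)])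
  show "continuous_on (Rn n) (\<lambda>x. norm (u x))" by (intro continuous_intros assms)
  show "AE x in lebesgue_n n. norm (u x) \<le> M"
    using esssup_AE[of "\<lambda>x. ereal (norm (u x))" "lebesgue_n n"] assms(2) by (simp add: Linf_norm_def)
qed

theorem theorem3p2:
  fixes W :: "real ^ 'm \<Rightarrow> real" and \<alpha> M :: real
  assumes "0 < \<alpha>" "\<alpha> < 1" "C2_holder \<alpha> W"
  shows "\<exists>C>0. \<forall>R>0. (\<forall>v. norm v > R \<longrightarrow> v \<bullet> grad W v > 0) \<longrightarrow>
    (\<forall>n\<ge>1. \<forall>u :: (nat \<Rightarrow> real) \<Rightarrow> real ^ 'm.
      Ck n 2 u \<longrightarrow> Linf_norm n u = ereal M \<longrightarrow>
      (\<forall>x\<in>Rn n. laplacian n u x = grad W (u x)) \<longrightarrow>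
        (\<forall>x\<in>Rn n. 1/2 * grad_norm_sq n u x \<le> C * (R\<^sup>2 - (norm (u x))\<^sup>2)) \<and>
        (\<forall>x\<in>Rn n. norm (u x) \<le> R) \<and>
        (\<not> u constant_on Rn n \<longrightarrow> (\<forall>x\<in>Rn n. norm (u x) < R)))"
proof -
  \<comment> \<open>\<open>C\<close> is chosen before \<open>R\<close>, so a radius depending on
    \<open>W\<close> alone is needed: the infimum of the admissible ones.\<close>
  define A where "A = {R::real. 0 \<le> R \<and> (\<forall>v. norm v > R \<longrightarrow> v \<bullet> grad W v > 0)}"
  define r where "r = Inf A"
  \<comment> \<open>Depends on \<open>W\<close> and \<open>M\<close> only;
    \<open>\<bar>M\<bar>\<close> keeps it nonnegative even when \<open>A\<close> is empty and its
    infimum is arbitrary.\<close>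
  define B where "B = max \<bar>M\<bar> r"
  have bdd: "bdd_below A" by (rule bdd_belowI[of _ 0]) (simp add: A_def)
  have B0: "0 \<le> B" by (simp add: B_def)
  obtain \<Lambda> where \<Lambda>: "\<Lambda> \<ge> 0"
    "\<And>v w. norm v \<le> B \<Longrightarrow> norm w \<le> B \<Longrightarrow> norm (grad W v - grad W w) \<le> \<Lambda> * norm (v - w)"
    using C2_holder_grad_lipschitz[OF assms(3,1) B0] by blast
  have cont: "continuous_on UNIV (grad W)"
    using assms(3) by (auto simp: C2_holder_def continuous_on_eq_continuous_at differentiable_imp_continuous_within)
  show ?thesis
  proof (intro exI[of _ "\<Lambda> + 1"] conjI allI impI)
    show "0 < \<Lambda> + 1" using \<Lambda>(1) by simp
  next
    fix R :: real and n :: nat and u :: "(nat \<Rightarrow> real) \<Rightarrow> real ^ 'm"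
    assume R: "0 < R" "\<forall>v. norm v > R \<longrightarrow> v \<bullet> grad W v > 0"
      and u: "Ck n 2 u" "Linf_norm n u = ereal M" "\<forall>x\<in>Rn n. laplacian n u x = grad W (u x)"
    have RA: "R \<in> A" using R by (simp add: A_def)
    have rR: "r \<le> R" unfolding r_def using RA bdd by (rule cInf_lower)
    have r0: "0 \<le> r" unfolding r_def using RA by (intro cInf_greatest) (auto simp: A_def)
    note tp = Ck_2_twice_partial[OF u(1)]
    interpret bounded_solution n u "\<lambda>i. partial i u" "\<lambda>i. partial i (partial i u)" "grad W" B r \<Lambda>
    proof
      show "norm (u x) \<le> B" if "x \<in> Rn n" for x
        using Linf_norm_imp_bounded[OF twice_partialD(1)[OF tp] u(2) that] by (simp add: B_def)
      \<comment> \<open>The infimum is itself admissible, as the condition concerns strictly larger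
        norms.\<close>
      show "0 < v \<bullet> grad W v" if v: "r < norm v" for v
      proof -
        obtain s where "s \<in> A" "s < norm v"
          using cInf_lessD[of A "norm v"] RA v by (auto simp: r_def)
        then show ?thesis by (simp add: A_def)
      qed
    qed (use tp u(3) \<Lambda> cont r0 in \<open>auto simp: laplacian_def B_def\<close>)
    show "\<forall>x\<in>Rn n. 1/2 * grad_norm_sq n u x \<le> (\<Lambda> + 1) * (R\<^sup>2 - (norm (u x))\<^sup>2)"
    proof
      fix x assume "x \<in> Rn n"
      then have "1/2 * grad_norm_sq n u x \<le> (\<Lambda> + 1) * (r\<^sup>2 - (norm (u x))\<^sup>2)"
        using gradient_estimate by (simp add: grad_norm_sq_def)
      also have "\<dots> \<le> (\<Lambda> + 1) * (R\<^sup>2 - (norm (u x))\<^sup>2)"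
        using rR r0 \<Lambda>(1) by (intro mult_left_mono diff_right_mono power_mono) auto
      finally show "1/2 * grad_norm_sq n u x \<le> (\<Lambda> + 1) * (R\<^sup>2 - (norm (u x))\<^sup>2)" .
    qed
    show "\<forall>x\<in>Rn n. norm (u x) \<le> R"
      using norm_le_R rR by (meson order_trans)
    show "\<forall>x\<in>Rn n. norm (u x) < R" if "\<not> u constant_on Rn n"
      using norm_less_R[OF that] rR by (meson less_le_trans)
  qed
qed

end
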